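(* For Lebesgue almost every $\omega \in (0,1)$, $$\lim_{n\to\infty}\frac{R_n(\omega)}{\sqrt{n}}=\sqrt{\frac{\pi}{\log 2}},$$ and for every integer $k\ge 1$, $$\lim_{n\to\infty}\frac{R_{n,k}(\omega)}{R_n(\omega)}=\frac{\binom{2k}{k}}{(2k-1)\cdot 4^k}=:r_k .$$ Moreover $\sum_{k=1}^\infty r_k=1$.
   Context: For irrational $\omega\in(0,1)$ write its continued fraction expansion $\omega=[a_1,a_2,\dots]=\cfrac{1}{a_1+\cfrac{1}{a_2+\cdots}}$ with partial quotients $a_i=a_i(\omega)\in\mathbb{N}$. For $x\in\mathbb{N}$ let $N_n(x,\omega)=\#\{1\le i\le n: a_i(\omega)=x\}$. Define $R_n(\omega)=\#\{x\in\mathbb{N}: N_n(x,\omega)\ge 1\}$ (the number of distinct values among $a_1(\omega),\dots,a_n(\omega)$) and, for $k\ge1$, $R_{n,k}(\omega)=\#\{x\in\mathbb{N}: N_n(x,\omega)=k\}$ (the number of distinct values appearing exactly $k$ times among $a_1(\omega),\dots,a_n(\omega)$). Here $\log$ is the natural logarithm. *)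

theory Defs
  imports "HOL-Analysis.Analysis"
begin

definition gauss_map :: "real \<Rightarrow> real" where
  "gauss_map w = frac (1 / w)"

definition cf_digit :: "nat \<Rightarrow> real \<Rightarrow> nat" where
  "cf_digit i w = nat \<lfloor>1 / ((gauss_map ^^ (i - 1)) w)\<rfloor>"

definition cf_count :: "nat \<Rightarrow> nat \<Rightarrow> real \<Rightarrow> nat" where
  "cf_count n x w = card {i \<in> {1..n}. cf_digit i w = x}"

definition cf_range :: "nat \<Rightarrow> real \<Rightarrow> nat" where
  "cf_range n w = card {x. cf_count n x w \<ge> 1}"

definition cf_range_k :: "nat \<Rightarrow> nat \<Rightarrow> real \<Rightarrow> nat" where
  "cf_range_k n k w = card {x. cf_count n x w = k}"

definition r_const :: "nat \<Rightarrow> real" where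
  "r_const k = real ((2*k) choose k) / ((2 * real k - 1) * 4 ^ k)"

end

theory Submission
  imports Defs "HOL-Probability.Distributions" "HOL-Real_Asymp.Real_Asymp"
begin

text \<open>
  Under Lebesgue measure the digits form a chain with complete connections: given the first
  \<open>n\<close> digits, the next one equals \<open>k\<close> with probability \<open>(1 + s) / ((k + s) (k + 1 + s))\<close>,
  where the state \<open>s\<close> is the quotient of consecutive convergent denominators, and the new state
  is \<open>1 / (k + s)\<close>. The transition operator contracts Lipschitz constants and preserves the Gauss
  density, so the averages of \<open>1 + s\<close> converge to \<open>1 / ln 2\<close> with variance of order \<open>1 / n\<close>.

  For \<open>z\<close> in \<open>[0, 1)\<close>, dividing \<open>z ^ N n x\<close> by its compensator gives for every digit \<open>x\<close> a
  martingale; these are negatively correlated for different \<open>x\<close>, and the compensator is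
  asymptotically \<open>exp (- (1 - z) n / (x\<^sup>2 ln 2))\<close>. Chebyshev's inequality along \<open>n = j ^ 4\<close> and
  monotonicity in \<open>n\<close> show that almost surely the sum over \<open>x\<close> of \<open>1 - z ^ N n x\<close> is asymptotic to
  the integral of \<open>1 - exp (- (1 - z) n / (x\<^sup>2 ln 2))\<close> over positive \<open>x\<close>, which is
  \<open>sqrt (pi (1 - z) n / ln 2)\<close>. For \<open>z = 0\<close> this is the number of distinct digits; in general, the
  generating function of the proportions of digits seen \<open>k\<close> times tends to \<open>1 - sqrt (1 - z)\<close>,
  whose coefficients are the constants \<open>r_k\<close>.
\<close>

section \<open>The limiting frequencies\<close>

text \<open>The digits are dependent, so the variance of a sum over many values x has to be
  controlled without independence. Dividing by the exact one-step conditional expectations keeps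
  every cross moment at most 1, because one digit cannot equal two values at once. The price is a
  random compensator. To first order in \<open>1 / x^2\<close> it depends on the path only through
  the sum of the states, so a single law of large numbers serves all x simultaneously. State 0 makes
  the initial law exactly Lebesgue measure on the unit interval. The approximation is uniform only
  while \<open>n / x^2\<close> stays bounded. Values below roughly \<open>sqrt n / e\<close> are
  therefore counted trivially, and e tends to infinity last; values above \<open>n^2\<close> are so
  rare that they can be cut off. Generating functions are evaluated only at z = 0 and z = 1/m, so
  countably many null sets suffice; since 1/m tends to 0, these points still determine all
  coefficients.\<close>

lemma central_binomial_Suc:
  "real ((2 * Suc k) choose Suc k) = real ((2 * k) choose k) * (2 * (2 * real k + 1)) / (real k + 1)"
proof -
  have eq: "real ((2 * m) choose m) = fact (2 * m) / (fact m * fact m)" for m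
    by (simp add: binomial_fact)
  have "fact (2 * Suc k) = (2 * real k + 2) * (2 * real k + 1) * fact (2 * k)"
    by (simp add: algebra_simps)
  moreover have "fact (Suc k) = (real k + 1) * fact k"
    by simp
  ultimately show ?thesis unfolding eq by (simp add: divide_simps) (simp add: algebra_simps)
qed

lemma r_const_Suc: "r_const (Suc k) = r_const k * (2 * real k - 1) / (2 * (real k + 1))"
proof -
  have "2 * real k \<noteq> 1"
    by (metis dvd_triv_left odd_one of_nat_1 of_nat_eq_iff of_nat_mult of_nat_numeral)
  then show ?thesis
    unfolding r_const_def central_binomial_Suc by (simp add: divide_simps) (simp add: algebra_simps)
qed

text \<open>Both sides start at -1 and satisfy the same two-term recursion. This identifies
  \<open>r_const\<close> as the coefficients of \<open>- sqrt (1 - z)\<close>.\<close>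

lemma r_const_gchoose: "r_const k = - ((1 / 2) gchoose k) * (- 1) ^ k"
proof (induction k)
  case 0
  show ?case by (simp add: r_const_def)
next
  case (Suc k)
  have g: "(1 / 2 :: real) gchoose Suc k = ((1 / 2) gchoose k) * (1 / 2 - real k) / (real k + 1)"
    using gbinomial_mult_1[of "1 / 2 :: real" k] by (simp add: divide_simps) (simp add: algebra_simps)
  show ?case unfolding r_const_Suc Suc.IH g by (simp add: divide_simps) (simp add: algebra_simps)
qed

lemma r_const_pgf:
  assumes "0 \<le> z" "z < 1"
  shows "(\<lambda>k. r_const k * z ^ k) sums (- sqrt (1 - z))"
proof -
  have "(\<lambda>k. ((1 / 2) gchoose k) * (- z) ^ k) sums sqrt (1 + - z)"
    by (rule sqrt_series) (use assms in auto)
  from sums_minus[OF this] show ?thesis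
    by (simp add: r_const_gchoose power_minus[of z] mult_ac)
qed

lemma r_const_nonneg: "k \<ge> 1 \<Longrightarrow> 0 \<le> r_const k"
  by (simp add: r_const_def)

text \<open>For simple random walk, \<open>r_const (k + 1)\<close> is the probability that the first
  return to 0 happens at time 2 (k + 1). It is the drop between two consecutive probabilities of
  being at 0, so the sum telescopes.\<close>

lemma r_const_partial_sum: "(\<Sum>k<n. r_const (k + 1)) = 1 - real ((2 * n) choose n) / 4 ^ n"
proof (induction n)
  case (Suc n)
  have "r_const (n + 1) = real ((2 * n) choose n) / 4 ^ n - real ((2 * Suc n) choose Suc n) / 4 ^ Suc n"
    unfolding r_const_def Suc_eq_plus1[symmetric] central_binomial_Suc
    by (simp add: divide_simps) (simp add: algebra_simps)
  then show ?case using Suc by simp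
qed simp

text \<open>Squaring removes the root from a Wallis-type bound; the induction step is
  \<open>(2 n + 1) (2 n + 3) \<le> (2 n + 2)^2\<close>.\<close>

lemma central_binomial_bound: "(real ((2 * n) choose n) / 4 ^ n)\<^sup>2 \<le> 1 / (2 * real n + 1)"
proof (induction n)
  case (Suc n)
  let ?b = "\<lambda>n. real ((2 * n) choose n) / 4 ^ n"
  have "?b (Suc n) = ?b n * ((2 * real n + 1) / (2 * real n + 2))"
    unfolding central_binomial_Suc by (simp add: divide_simps) (simp add: algebra_simps)
  then have "(?b (Suc n))\<^sup>2 = (?b n)\<^sup>2 * ((2 * real n + 1) / (2 * real n + 2))\<^sup>2"
    by (simp only: power_mult_distrib)
  also have "\<dots> \<le> 1 / (2 * real n + 1) * ((2 * real n + 1) / (2 * real n + 2))\<^sup>2"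
    by (intro mult_right_mono Suc) auto
  also have "\<dots> = (2 * real n + 1) / (2 * real n + 2)\<^sup>2"
    by (simp add: power2_eq_square divide_simps)
  also have "\<dots> \<le> 1 / (2 * real (Suc n) + 1)"
    by (simp add: divide_simps) (simp add: power2_eq_square algebra_simps)
  finally show ?case .
qed simp

lemma r_const_sums: "(\<lambda>k. r_const (k + 1)) sums 1"
proof -
  have "(\<lambda>n. 1 / (2 * real n + 1)) \<longlonglongrightarrow> 0" by real_asymp
  then have "(\<lambda>n. (real ((2 * n) choose n) / 4 ^ n)\<^sup>2) \<longlonglongrightarrow> 0"
    by (rule tendsto_sandwich[OF _ _ tendsto_const, rotated 2])
       (auto intro: always_eventually central_binomial_bound)
  then have "(\<lambda>n. real ((2 * n) choose n) / 4 ^ n) \<longlonglongrightarrow> 0"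
    by simp
  then show ?thesis
    unfolding sums_def r_const_partial_sum using tendsto_diff[OF tendsto_const[of 1]] by fastforce
qed

lemma r_const_le_1:
  assumes "k \<ge> 1"
  shows "r_const k \<le> 1"
proof -
  have "sum (\<lambda>i. r_const (i + 1)) {k - 1} \<le> (\<Sum>i. r_const (i + 1))"
    by (intro sum_le_suminf) (auto intro!: r_const_nonneg sums_summable[OF r_const_sums[unfolded Suc_eq_plus1[symmetric]]])
  then show ?thesis using assms r_const_sums by (simp add: sums_iff)
qed

text \<open>A continuity theorem for generating functions. Once the lower coefficients tend to 0,
  division by \<open>z^k\<close> isolates \<open>b n k\<close> up to a tail of at most
  \<open>2 z\<close>, uniformly in n; so z is fixed small before n grows.\<close>

lemma power_series_coeffs_tendsto_0:
  fixes b :: "nat \<Rightarrow> nat \<Rightarrow> real"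
  assumes b: "\<And>n k. \<bar>b n k\<bar> \<le> 1"
    and lim: "\<And>m. m \<ge> 2 \<Longrightarrow> (\<lambda>n. \<Sum>k. b n k * (1 / real m) ^ k) \<longlonglongrightarrow> 0"
  shows "(\<lambda>n. b n k) \<longlonglongrightarrow> 0"
proof (induction k rule: less_induct)
  case (less k)
  show ?case
  proof (rule LIMSEQ_I)
    fix e :: real assume "e > 0"
    \<comment> \<open>For z = 1/m this pushes the tail bound \<open>2 z\<close> below e/2; the
      maximum with 2 gives z \<le> 1/2, so the geometric factor is at most 2.\<close>
    obtain m0 :: nat where m0: "real m0 > 4 / e" using reals_Archimedean2 by blast
    define m where "m = max 2 m0"
    define z where "z = 1 / real m"
    have m: "m \<ge> 2" "real m > 4 / e" using m0 by (auto simp: m_def)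
    have z: "0 < z" "z \<le> 1 / 2" "2 * z < e / 2"
      using m \<open>e > 0\<close> by (auto simp: z_def field_simps)
    have smz: "summable (\<lambda>k. z ^ k)" by (rule summable_geometric) (use z in auto)
    have sm: "summable (\<lambda>k. b n k * z ^ k)" for n
      by (rule summable_comparison_test'[OF smz, of 0]) (use b z in \<open>auto simp: abs_mult intro!: mult_left_le_one_le\<close>)
    have "(\<lambda>n. ((\<Sum>k. b n k * z ^ k) - (\<Sum>i<k. b n i * z ^ i)) / z ^ k) \<longlonglongrightarrow> (0 - (\<Sum>i<k. 0 * z ^ i)) / z ^ k"
      using lim[OF m(1)] less unfolding z_def[symmetric]
      by (intro tendsto_intros) (use z in auto)
    then have "(\<lambda>n. ((\<Sum>k. b n k * z ^ k) - (\<Sum>i<k. b n i * z ^ i)) / z ^ k) \<longlonglongrightarrow> 0" by simp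
    from LIMSEQ_D[OF this, of "e / 2"] \<open>e > 0\<close> obtain N where
      N: "\<And>n. n \<ge> N \<Longrightarrow> \<bar>((\<Sum>k. b n k * z ^ k) - (\<Sum>i<k. b n i * z ^ i)) / z ^ k\<bar> < e / 2" by auto
    have "\<bar>b n k\<bar> < e" if "n \<ge> N" for n
    proof -
      have tail: "\<bar>\<Sum>i. b n (i + Suc k) * z ^ (i + Suc k)\<bar> \<le> 2 * z ^ Suc k"
      proof -
        have "\<bar>\<Sum>i. b n (i + Suc k) * z ^ (i + Suc k)\<bar> \<le> (\<Sum>i. z ^ Suc k * z ^ i)"
        proof -
          have le: "norm (b n (i + Suc k) * z ^ (i + Suc k)) \<le> z ^ Suc k * z ^ i" for i
            using b[of n "i + Suc k"] z by (auto simp: abs_mult power_add mult_ac intro!: mult_left_le_one_le)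
          have sg: "summable (\<lambda>i. z ^ Suc k * z ^ i)" by (rule summable_mult[OF smz])
          have sn: "summable (\<lambda>i. norm (b n (i + Suc k) * z ^ (i + Suc k)))"
            by (rule summable_comparison_test'[OF sg, of 0]) (use le in auto)
          show ?thesis
            using order_trans[OF summable_norm[OF sn] suminf_le[OF le sn sg]] by simp
        qed
        also have "\<dots> = z ^ Suc k * (1 / (1 - z))"
          by (subst suminf_mult[OF smz]) (subst suminf_geometric, use z in auto)
        also have "\<dots> \<le> z ^ Suc k * 2" using z by (intro mult_left_mono) (auto simp: field_simps)
        finally show ?thesis by simp
      qed
      have "(\<Sum>k. b n k * z ^ k) = (\<Sum>i. b n (i + Suc k) * z ^ (i + Suc k)) + (\<Sum>i<Suc k. b n i * z ^ i)"
        by (rule suminf_split_initial_segment[OF sm])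
      then have *: "b n k * z ^ k = ((\<Sum>k. b n k * z ^ k) - (\<Sum>i<k. b n i * z ^ i)) -
         (\<Sum>i. b n (i + Suc k) * z ^ (i + Suc k))" by simp
      have "b n k = ((\<Sum>k. b n k * z ^ k) - (\<Sum>i<k. b n i * z ^ i)) / z ^ k -
         (\<Sum>i. b n (i + Suc k) * z ^ (i + Suc k)) / z ^ k"
        unfolding diff_divide_distrib[symmetric] *[symmetric] using z by simp
      moreover have "\<bar>(\<Sum>i. b n (i + Suc k) * z ^ (i + Suc k)) / z ^ k\<bar> \<le> 2 * z"
        using tail z by (simp add: abs_divide divide_simps mult_ac)
      ultimately show ?thesis using N[OF that] z(3) by linarith
    qed
    then show "\<exists>N. \<forall>n\<ge>N. norm (b n k - 0) < e" by auto
  qed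
qed

section \<open>A Riemann sum\<close>

text \<open>The summand decreases in x, so the sum is squeezed between increments of an explicit
  antiderivative. The cutoff \<open>X j\<close> is harmless because it outgrows the scale
  \<open>t j\<close>.\<close>

lemma riemann_sum_exp_inverse_square:
  fixes \<gamma> :: real and t :: "nat \<Rightarrow> real" and X :: "nat \<Rightarrow> nat"
  assumes lam: "\<gamma> > 0" and t: "filterlim t at_top sequentially"
    and X: "filterlim (\<lambda>j. real (X j) / t j) at_top sequentially"
  shows "(\<lambda>j. (\<Sum>x=1..X j. 1 - exp (- \<gamma> * (t j)\<^sup>2 / (real x)\<^sup>2)) / t j) \<longlonglongrightarrow> sqrt (pi * \<gamma>)"
proof -
  define \<phi> where "\<phi> u = 1 - exp (- \<gamma> / u\<^sup>2)" for u :: real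
  define E where "E y = integral {0..y} (\<lambda>v::real. exp (- v\<^sup>2))" for y
  \<comment> \<open>Integration by parts of \<open>\<phi>\<close>, followed by the substitution
    \<open>v = sqrt \<gamma> / u\<close>, gives this antiderivative. Its increment from 0 to
    infinity is the limit.\<close>
  define F where "F u = u * \<phi> u - 2 * sqrt \<gamma> * E (sqrt \<gamma> / u)" for u
  have E_deriv: "(E has_real_derivative exp (- y\<^sup>2)) (at y)" if "y > 0" for y
  proof -
    have "(E has_real_derivative exp (- y\<^sup>2)) (at y within {0..y + 1})"
      unfolding E_def[abs_def]
      by (rule integral_has_real_derivative) (use that in \<open>auto intro!: continuous_intros\<close>)
    then show ?thesis using that by (simp add: at_within_Icc_at)
  qed
  have E_top: "(E \<longlongrightarrow> sqrt pi / 2) at_top"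
  proof -
    have int: "integrable lborel (\<lambda>x::real. indicator {0..} x *\<^sub>R exp (- x\<^sup>2))"
      and eq: "(\<integral>x. indicator {0..} x *\<^sub>R exp (- x\<^sup>2) \<partial>lborel) = sqrt pi / 2"
      using gaussian_moment_0 by (auto simp: has_bochner_integral_iff)
    have "((\<lambda>y. \<integral>x. indicator {..y} x *\<^sub>R (indicator {0..} x *\<^sub>R exp (- x\<^sup>2)) \<partial>lborel) \<longlongrightarrow> sqrt pi / 2) at_top"
      unfolding eq[symmetric] by (rule tendsto_integral_at_top[OF _ int]) simp
    moreover have "(\<integral>x. indicator {..y} x *\<^sub>R (indicator {0..} x *\<^sub>R exp (- x\<^sup>2)) \<partial>lborel) = E y" for y :: real
    proof -
      have "(\<integral>x. indicator {..y} x *\<^sub>R (indicator {0..} x *\<^sub>R exp (- x\<^sup>2)) \<partial>lborel) =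
        (LINT x:{0..y}|lborel. exp (- x\<^sup>2))"
        unfolding set_lebesgue_integral_def by (intro Bochner_Integration.integral_cong) (auto split: split_indicator)
      also have "\<dots> = E y"
        unfolding E_def by (intro set_borel_integral_eq_integral borel_integrable_atLeastAtMost' continuous_intros)
      finally show ?thesis .
    qed
    ultimately show ?thesis by simp
  qed
  have E_0: "(E \<longlongrightarrow> 0) (at_right 0)"
  proof (rule tendsto_sandwich[of "\<lambda>_. 0" _ _ "\<lambda>y. y"])
    have b: "0 \<le> E y \<and> E y \<le> y" if "y > 0" for y
    proof
      show "0 \<le> E y" unfolding E_def
        by (rule integral_nonneg) (auto intro!: integrable_continuous_interval continuous_intros)
      have "E y \<le> integral {0..y} (\<lambda>v. 1)" unfolding E_def
        by (rule integral_le) (auto intro!: integrable_continuous_interval continuous_intros)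
      then show "E y \<le> y" using that by simp
    qed
    show "\<forall>\<^sub>F y in at_right 0. 0 \<le> E y" "\<forall>\<^sub>F y in at_right 0. E y \<le> y"
      using b by (auto simp: eventually_at_right_field intro!: exI[of _ 1])
  qed (auto intro!: tendsto_eq_intros)
  have F_deriv: "(F has_real_derivative \<phi> u) (at u)" if "u > 0" for u
  proof -
    have sq: "sqrt \<gamma> / u > 0" "sqrt \<gamma> * sqrt \<gamma> = \<gamma>" "(sqrt \<gamma> / u)\<^sup>2 = \<gamma> / u\<^sup>2" using lam that by (auto simp: power_divide)
    have d1: "((\<lambda>u. E (sqrt \<gamma> / u)) has_real_derivative exp (- (sqrt \<gamma> / u)\<^sup>2) * (- (sqrt \<gamma> / u\<^sup>2))) (at u)"
      by (rule DERIV_chain2[of E _ "\<lambda>u. sqrt \<gamma> / u", OF E_deriv[OF sq(1)]])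
         (use that in \<open>auto intro!: derivative_eq_intros simp: power2_eq_square\<close>)
    have d2: "(\<phi> has_real_derivative - (exp (- \<gamma> / u\<^sup>2) * (2 * \<gamma> / u ^ 3))) (at u)"
      unfolding \<phi>_def[abs_def] using that
      by (auto intro!: derivative_eq_intros simp: power2_eq_square power3_eq_cube field_simps)
    have "(F has_real_derivative (1 * \<phi> u + - (exp (- \<gamma> / u\<^sup>2) * (2 * \<gamma> / u ^ 3)) * u -
       2 * sqrt \<gamma> * (exp (- (sqrt \<gamma> / u)\<^sup>2) * (- (sqrt \<gamma> / u\<^sup>2))))) (at u)"
      unfolding F_def[abs_def] by (intro DERIV_diff DERIV_mult DERIV_cmult DERIV_ident d1 d2)
    moreover have "(1 * \<phi> u + - (exp (- \<gamma> / u\<^sup>2) * (2 * \<gamma> / u ^ 3)) * u -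
       2 * sqrt \<gamma> * (exp (- (sqrt \<gamma> / u)\<^sup>2) * (- (sqrt \<gamma> / u\<^sup>2)))) = \<phi> u"
      unfolding sq(3) using that sq(2) by (simp add: power2_eq_square power3_eq_cube field_simps)
    ultimately show ?thesis by simp
  qed
  have F_top: "(F \<longlongrightarrow> 0) at_top"
  proof -
    have "((\<lambda>u. u * \<phi> u) \<longlongrightarrow> 0) at_top" unfolding \<phi>_def using lam by real_asymp
    moreover have "filterlim (\<lambda>u. sqrt \<gamma> / u) (at_right 0) at_top" using lam by real_asymp
    ultimately have "(F \<longlongrightarrow> 0 - 2 * sqrt \<gamma> * 0) at_top"
      unfolding F_def[abs_def] by (intro tendsto_intros filterlim_compose[OF E_0])
    then show ?thesis by simp
  qed
  have F_0: "(F \<longlongrightarrow> - sqrt (pi * \<gamma>)) (at_right 0)"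
  proof -
    have "((\<lambda>u. u * \<phi> u) \<longlongrightarrow> 0) (at_right 0)" unfolding \<phi>_def using lam by real_asymp
    moreover have "filterlim (\<lambda>u. sqrt \<gamma> / u) at_top (at_right 0)" using lam by real_asymp
    ultimately have "(F \<longlongrightarrow> 0 - 2 * sqrt \<gamma> * (sqrt pi / 2)) (at_right 0)"
      unfolding F_def[abs_def] by (intro tendsto_intros filterlim_compose[OF E_top])
    then show ?thesis by (simp add: real_sqrt_mult mult.commute)
  qed
  have phi_mono: "\<phi> v \<le> \<phi> u" if "0 < u" "u \<le> v" for u v
  proof -
    have "\<gamma> / v\<^sup>2 \<le> \<gamma> / u\<^sup>2" using that lam by (intro divide_left_mono power_mono) auto
    then show ?thesis by (simp add: \<phi>_def)
  qed
  have step: "F (real (Suc x) / t) - F (real x / t) \<le> \<phi> (real x / t) / t"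
    "\<phi> (real (Suc x) / t) / t \<le> F (real (Suc x) / t) - F (real x / t)" if "t > 0" "x \<ge> 1" for t x
  proof -
    have p: "0 < real x / t" "real x / t < real (Suc x) / t" using that by (auto simp: divide_simps)
    obtain \<xi> where xi: "real x / t < \<xi>" "\<xi> < real (Suc x) / t"
      "F (real (Suc x) / t) - F (real x / t) = (real (Suc x) / t - real x / t) * \<phi> \<xi>"
      using MVT2[OF p(2), of F \<phi>] F_deriv p(1) by (metis order_less_le_trans)
    have "0 < \<xi>" using p xi by linarith
    have "real (Suc x) / t - real x / t = 1 / t" by (simp add: diff_divide_distrib[symmetric])
    with xi(3) have eq: "F (real (Suc x) / t) - F (real x / t) = \<phi> \<xi> / t" by simp
    show "F (real (Suc x) / t) - F (real x / t) \<le> \<phi> (real x / t) / t"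
      unfolding eq using that p xi \<open>0 < \<xi>\<close> by (intro divide_right_mono phi_mono) auto
    show "\<phi> (real (Suc x) / t) / t \<le> F (real (Suc x) / t) - F (real x / t)"
      unfolding eq using that p xi \<open>0 < \<xi>\<close> by (intro divide_right_mono phi_mono) auto
  qed
  have lower: "F (real (Suc n) / t) - F (1 / t) \<le> (\<Sum>x=1..n. \<phi> (real x / t) / t)" if "t > 0" for t n
  proof (induction n)
    case (Suc n)
    then show ?case using step(1)[OF that, of "Suc n"] by simp
  qed simp
  \<comment> \<open>The comparison interval for x = 1 would reach down to 0, so that term is bounded
    by \<open>1 / t\<close> through \<open>\<phi> \<le> 1\<close>.\<close>
  have upper: "(\<Sum>x=1..n. \<phi> (real x / t) / t) \<le> 1 / t + F (real n / t) - F (1 / t)" if "t > 0" "n \<ge> 1" for t n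
    using that(2)
  proof (induction n rule: dec_induct)
    case base
    show ?case using that by (simp add: \<phi>_def divide_simps)
  next
    case (step n)
    then show ?case using \<open>\<And>x t. _ \<Longrightarrow> _ \<Longrightarrow> \<phi> (real (Suc x) / t) / t \<le> _\<close>[OF that(1), of n] by simp
  qed
  have tpos: "\<forall>\<^sub>F j in sequentially. t j > 0" using t by (simp add: filterlim_at_top_dense)
  have Xpos: "\<forall>\<^sub>F j in sequentially. X j \<ge> 1"
  proof -
    have "\<forall>\<^sub>F j in sequentially. real (X j) / t j > 0" using X by (simp add: filterlim_at_top_dense)
    then show ?thesis by eventually_elim (auto simp: zero_less_divide_iff Suc_le_eq intro: gr0I)
  qed
  have inv: "filterlim (\<lambda>j. 1 / t j) (at_right 0) sequentially"
    using filterlim_compose[OF filterlim_inverse_at_right_top t] by (simp add: inverse_eq_divide)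
  have l1: "(\<lambda>j. F (1 / t j)) \<longlonglongrightarrow> - sqrt (pi * \<gamma>)" by (rule filterlim_compose[OF F_0 inv])
  have l2: "(\<lambda>j. F (real (X j) / t j)) \<longlonglongrightarrow> 0" by (rule filterlim_compose[OF F_top X])
  have l3: "(\<lambda>j. F (real (Suc (X j)) / t j)) \<longlonglongrightarrow> 0"
  proof (rule filterlim_compose[OF F_top], rule filterlim_at_top_mono[OF X])
    show "\<forall>\<^sub>F j in sequentially. real (X j) / t j \<le> real (Suc (X j)) / t j"
      using tpos by eventually_elim (auto simp: divide_simps)
  qed
  have l4: "(\<lambda>j. 1 / t j) \<longlonglongrightarrow> 0" using inv by (simp add: filterlim_at)
  have "(\<lambda>j. (\<Sum>x=1..X j. \<phi> (real x / t j) / t j)) \<longlonglongrightarrow> sqrt (pi * \<gamma>)"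
  proof (rule tendsto_sandwich)
    show "\<forall>\<^sub>F j in sequentially. F (real (Suc (X j)) / t j) - F (1 / t j) \<le> (\<Sum>x=1..X j. \<phi> (real x / t j) / t j)"
      using tpos by eventually_elim (rule lower)
    show "\<forall>\<^sub>F j in sequentially. (\<Sum>x=1..X j. \<phi> (real x / t j) / t j) \<le> 1 / t j + F (real (X j) / t j) - F (1 / t j)"
      using tpos Xpos by eventually_elim (rule upper)
    show "(\<lambda>j. F (real (Suc (X j)) / t j) - F (1 / t j)) \<longlonglongrightarrow> sqrt (pi * \<gamma>)"
      using tendsto_diff[OF l3 l1] by simp
    show "(\<lambda>j. 1 / t j + F (real (X j) / t j) - F (1 / t j)) \<longlonglongrightarrow> sqrt (pi * \<gamma>)"
      using tendsto_diff[OF tendsto_add[OF l4 l2] l1] by simp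
  qed
  then show ?thesis
    by (simp add: \<phi>_def power_divide sum_divide_distrib)
qed

section \<open>The digit chain\<close>

text \<open>The maximum only matters off the irrationals of the unit interval. It keeps
  \<open>1 / (digit w + s)\<close> in \<open>[0, 1]\<close> for every real \<open>w\<close>, so the processes
  below are bounded everywhere and not just almost everywhere.\<close>

definition digit :: "real \<Rightarrow> nat" where
  "digit w = max 1 (nat \<lfloor>1 / w\<rfloor>)"

definition digit_prob :: "nat \<Rightarrow> real \<Rightarrow> real" where
  "digit_prob k s = (1 + s) / ((real k + s) * (real k + 1 + s))"

text \<open>If \<open>q n\<close> are the denominators of the convergents of a uniformly distributed
  point, then \<open>cf_measure (q (n - 1) / q n)\<close> is the conditional law of its \<open>n\<close>-th Gauss
  iterate given the first \<open>n\<close> digits, and \<open>digit_prob\<close> the conditional law of the next digit.\<close>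

definition cf_measure :: "real \<Rightarrow> real measure" where
  "cf_measure s = density lborel (\<lambda>w. ennreal ((1 + s) / (1 + s * w)\<^sup>2) * indicator {0<..<1} w)"

lemma digit_ge_1: "digit w \<ge> 1"
  by (simp add: digit_def)

lemma digit_branch:
  assumes "0 < v" "v < 1"
  shows "digit (1 / (real (Suc k) + v)) = Suc k" "gauss_map (1 / (real (Suc k) + v)) = v"
proof -
  have "\<lfloor>real (Suc k) + v\<rfloor> = int (Suc k)"
    using assms by (intro floor_unique) auto
  then show "digit (1 / (real (Suc k) + v)) = Suc k"
    using assms by (simp add: digit_def)
  from \<open>\<lfloor>real (Suc k) + v\<rfloor> = int (Suc k)\<close> show "gauss_map (1 / (real (Suc k) + v)) = v"
    by (simp add: gauss_map_def frac_def)
qed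

lemma measurable_digit [measurable]: "digit \<in> borel \<rightarrow>\<^sub>M count_space UNIV"
  unfolding digit_def by measurable

lemma measurable_gauss_map [measurable]: "gauss_map \<in> borel_measurable borel"
  unfolding gauss_map_def[abs_def] frac_def by measurable

lemma sets_cf_measure [simp, measurable_cong]: "sets (cf_measure s) = sets borel"
  by (simp add: cf_measure_def)

lemma space_cf_measure [simp]: "space (cf_measure s) = UNIV"
  by (simp add: cf_measure_def)

lemma nn_integral_cf_measure:
  assumes [measurable]: "f \<in> borel_measurable borel"
  shows "(\<integral>\<^sup>+w. f w \<partial>cf_measure s) =
    (\<integral>\<^sup>+w\<in>{0<..<1}. (ennreal ((1 + s) / (1 + s * w)\<^sup>2) * f w) \<partial>lborel)"
  unfolding cf_measure_def by (subst nn_integral_density) (auto intro!: nn_integral_cong simp: mult_ac)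

lemma digit_prob_nonneg: "s \<ge> 0 \<Longrightarrow> digit_prob k s \<ge> 0"
  by (simp add: digit_prob_def)

lemma digit_prob_sums:
  assumes "0 \<le> s"
  shows "(\<lambda>k. digit_prob (Suc k) s) sums 1"
proof -
  have lim: "(\<lambda>k. (1 + s) / (real k + 1 + s)) \<longlonglongrightarrow> 0"
    by real_asymp
  have "(\<lambda>k. (1 + s) / (real k + 1 + s) - (1 + s) / (real (Suc k) + 1 + s)) sums
      ((1 + s) / (real 0 + 1 + s) - 0)"
    by (rule telescope_sums'[OF lim])
  also have "(\<lambda>k. (1 + s) / (real k + 1 + s) - (1 + s) / (real (Suc k) + 1 + s)) =
      (\<lambda>k. digit_prob (Suc k) s)"
    using assms by (auto simp: digit_prob_def fun_eq_iff divide_simps) (auto simp: algebra_simps)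
  finally show ?thesis using assms by simp
qed

text \<open>\<open>B k\<close> is the cylinder on which the first digit is k + 1, and
  \<open>w = 1 / (k + 1 + v)\<close> parametrises it. Half-open intervals make the cylinders
  disjoint; the endpoints are null sets.\<close>

lemma nn_integral_gauss_branches:
  assumes [measurable]: "f \<in> borel_measurable borel"
  shows "(\<integral>\<^sup>+w\<in>{0<..<1}. f w \<partial>lborel) =
    (\<Sum>k. \<integral>\<^sup>+v\<in>{0<..<1}. (f (1 / (real (Suc k) + v)) * ennreal (1 / (real (Suc k) + v)\<^sup>2)) \<partial>lborel)"
proof -
  define B where "B k = {1 / (real k + 2) <.. 1 / (real k + 1)}" for k
  have UB: "(\<Union>k. B k) = {0<..1}"
  proof (intro equalityI subsetI)
    fix w :: real assume "w \<in> (\<Union>k. B k)"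
    then obtain k where k: "1 / (real k + 2) < w" "w \<le> 1 / (real k + 1)" by (auto simp: B_def)
    have "0 < 1 / (real k + 2)" "1 / (real k + 1) \<le> 1" by auto
    with k show "w \<in> {0<..1}" unfolding greaterThanAtMost_iff by linarith
  next
    fix w :: real assume w: "w \<in> {0<..1}"
    define k where "k = nat (\<lfloor>1 / w\<rfloor> - 1)"
    have "1 / w \<ge> 1" using w by simp
    then have "\<lfloor>1 / w\<rfloor> \<ge> 1" by linarith
    then have "real k = of_int \<lfloor>1 / w\<rfloor> - 1" by (simp add: k_def)
    then have "real k + 1 \<le> 1 / w" "1 / w < real k + 2" by linarith+
    then have "w \<in> B k" using w by (auto simp: B_def field_simps)
    then show "w \<in> (\<Union>k. B k)" by blast
  qed
  have less: "w \<notin> B l" if "k < l" "w \<in> B k" for k l w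
  proof -
    have "1 / (real l + 1) \<le> 1 / (real k + 2)" using that(1) by (intro divide_left_mono) auto
    then show ?thesis using that(2) by (auto simp: B_def)
  qed
  have disj: "disjoint_family B"
    unfolding disjoint_family_on_def by (metis IntE UNIV_I equals0I less linorder_neqE_nat)
  have branch: "(\<integral>\<^sup>+w\<in>B k. f w \<partial>lborel) =
    (\<integral>\<^sup>+v\<in>{0<..<1}. (f (1 / (real (Suc k) + v)) * ennreal (1 / (real (Suc k) + v)\<^sup>2)) \<partial>lborel)" for k
  proof -
    \<comment> \<open>The inverse branch is decreasing, whereas the substitution rule asks for a
      nonnegative derivative; hence the reflection to the negative axis.\<close>
    let ?g = "\<lambda>v. - (1 / (real (Suc k) + v))"
    have "(\<integral>\<^sup>+w\<in>B k. f w \<partial>lborel) = (\<integral>\<^sup>+w\<in>{1 / (real k + 2)..1 / (real k + 1)}. f w \<partial>lborel)"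
      by (rule nn_integral_cong_AE, rule AE_mp[OF AE_lborel_singleton[of "1 / (real k + 2)"]])
         (auto simp: B_def split: split_indicator)
    also have "\<dots> = (\<integral>\<^sup>+u. f (- u) * indicator {1 / (real k + 2)..1 / (real k + 1)} (- u) \<partial>lborel)"
      by (subst nn_integral_real_affine[where c = "-1" and t = 0]) auto
    also have "\<dots> = (\<integral>\<^sup>+u. f (- u) * indicator {?g 0..?g 1} u \<partial>lborel)"
      by (intro nn_integral_cong) (auto split: split_indicator simp: add_ac)
    also have "\<dots> = (\<integral>\<^sup>+v. f (- ?g v) * ennreal (1 / (real (Suc k) + v)\<^sup>2) * indicator {0..1} v \<partial>lborel)"
      by (rule nn_integral_substitution_aux)
         (auto intro!: derivative_eq_intros continuous_intros simp: power2_eq_square)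
    also have "\<dots> = (\<integral>\<^sup>+v\<in>{0<..<1}. (f (1 / (real (Suc k) + v)) * ennreal (1 / (real (Suc k) + v)\<^sup>2)) \<partial>lborel)"
      by (rule nn_integral_cong_AE,
          rule AE_mp[OF AE_lborel_singleton[of 0] AE_mp[OF AE_lborel_singleton[of 1]]])
         (auto split: split_indicator)
    finally show ?thesis .
  qed
  have "(\<integral>\<^sup>+w\<in>{0<..<1}. f w \<partial>lborel) = (\<integral>\<^sup>+w\<in>(\<Union>k. B k). f w \<partial>lborel)"
    unfolding UB by (rule nn_integral_cong_AE, rule AE_mp[OF AE_lborel_singleton[of 1]])
      (auto split: split_indicator)
  also have "\<dots> = (\<Sum>k. \<integral>\<^sup>+w\<in>B k. f w \<partial>lborel)"
    by (rule nn_integral_disjoint_family[OF _ _ disj]) (auto simp: B_def)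
  finally show ?thesis by (simp add: branch)
qed

lemma nn_integral_unit_interval_FTC:
  fixes f F :: "real \<Rightarrow> real"
  assumes [measurable]: "f \<in> borel_measurable borel"
    and "\<And>x. 0 \<le> x \<Longrightarrow> x \<le> 1 \<Longrightarrow> DERIV F x :> f x" "\<And>x. 0 \<le> x \<Longrightarrow> x \<le> 1 \<Longrightarrow> 0 \<le> f x"
  shows "(\<integral>\<^sup>+w\<in>{0<..<1}. ennreal (f w) \<partial>lborel) = ennreal (F 1 - F 0)"
proof -
  have "(\<integral>\<^sup>+w\<in>{0<..<1}. ennreal (f w) \<partial>lborel) = (\<integral>\<^sup>+w. ennreal (f w) * indicator {0..1} w \<partial>lborel)"
    by (rule nn_integral_cong_AE,
          rule AE_mp[OF AE_lborel_singleton[of 0] AE_mp[OF AE_lborel_singleton[of 1]]])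
         (auto split: split_indicator)
  also have "\<dots> = ennreal (F 1 - F 0)"
    by (rule nn_integral_FTC_Icc) (use assms in auto)
  finally show ?thesis .
qed

lemma prob_space_cf_measure:
  assumes s: "0 \<le> s"
  shows "prob_space (cf_measure s)"
proof (rule prob_spaceI)
  have pos: "1 + s * x > 0" if "0 \<le> x" for x using s that
    by (intro add_pos_nonneg) auto
  have "emeasure (cf_measure s) (space (cf_measure s)) = (\<integral>\<^sup>+w. 1 \<partial>cf_measure s)"
    by simp
  also have "\<dots> = (\<integral>\<^sup>+w\<in>{0<..<1}. ennreal ((1 + s) / (1 + s * w)\<^sup>2) \<partial>lborel)"
    by (subst nn_integral_cf_measure) auto
  also have "\<dots> = ennreal ((1 + s) * 1 / (1 + s * 1) - (1 + s) * 0 / (1 + s * 0))"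
  proof (rule nn_integral_unit_interval_FTC)
    fix x :: real assume x: "0 \<le> x"
    have "1 + s * x \<noteq> 0" using pos[OF x] by simp
    then show "((\<lambda>w. (1 + s) * w / (1 + s * w)) has_field_derivative (1 + s) / (1 + s * x)\<^sup>2) (at x)"
      by (auto intro!: derivative_eq_intros simp: power2_eq_square field_simps)
  qed (use s in auto)
  also have "\<dots> = 1" using s by simp
  finally show "emeasure (cf_measure s) (space (cf_measure s)) = 1" .
qed

text \<open>The family of densities is closed under the inverse branches: at
  \<open>1 / (K + v)\<close>, the density for s times the Jacobian is \<open>digit_prob K s\<close>
  times the density for \<open>1 / (K + s)\<close> at v. This is the Markov property on which the
  later expectations rest.\<close>

lemma nn_integral_cf_measure_step:
  assumes s: "0 \<le> s" and F [measurable]: "\<And>k. F k \<in> borel_measurable borel"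
  shows "(\<integral>\<^sup>+w. F (digit w) (gauss_map w) \<partial>cf_measure s) =
    (\<Sum>k. ennreal (digit_prob (Suc k) s) * (\<integral>\<^sup>+v. F (Suc k) v \<partial>cf_measure (1 / (real (Suc k) + s))))"
proof -
  have [measurable]: "(\<lambda>w. F (digit w) (gauss_map w)) \<in> borel_measurable borel"
    by (rule measurable_compose_countable[of "\<lambda>i w. F i (gauss_map w)"]) measurable
  have "(\<integral>\<^sup>+w. F (digit w) (gauss_map w) \<partial>cf_measure s) =
    (\<integral>\<^sup>+w\<in>{0<..<1}. (ennreal ((1 + s) / (1 + s * w)\<^sup>2) * F (digit w) (gauss_map w)) \<partial>lborel)"
    by (rule nn_integral_cf_measure) simp
  also have "\<dots> = (\<Sum>k. \<integral>\<^sup>+v\<in>{0<..<1}. (ennreal ((1 + s) / (1 + s * (1 / (real (Suc k) + v)))\<^sup>2)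
       * F (digit (1 / (real (Suc k) + v))) (gauss_map (1 / (real (Suc k) + v)))
       * ennreal (1 / (real (Suc k) + v)\<^sup>2)) \<partial>lborel)"
    by (rule nn_integral_gauss_branches) simp
  also have "\<dots> = (\<Sum>k. ennreal (digit_prob (Suc k) s) * (\<integral>\<^sup>+v. F (Suc k) v \<partial>cf_measure (1 / (real (Suc k) + s))))"
  proof (intro suminf_cong)
    fix k
    let ?K = "real (Suc k)"
    let ?s' = "1 / (?K + s)"
    have eq: "(1 + s) / (1 + s * (1 / (?K + v)))\<^sup>2 * (1 / (?K + v)\<^sup>2) =
       digit_prob (Suc k) s * ((1 + ?s') / (1 + ?s' * v)\<^sup>2)" if "0 < v" for v
    proof -
      have p: "?K + v > 0" "?K + s > 0" "?K + s + v > 0" "?K + 1 + s > 0" using that s by auto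
      have a: "1 + s * (1 / (?K + v)) = (?K + s + v) / (?K + v)" using p by (simp add: field_simps)
      have b: "1 + ?s' * v = (?K + s + v) / (?K + s)" using p by (simp add: field_simps)
      have c: "1 + ?s' = (?K + 1 + s) / (?K + s)" using p by (simp add: field_simps)
      show ?thesis unfolding a b c digit_prob_def using p
        by (simp add: power_divide power2_eq_square)
    qed
    have "(\<integral>\<^sup>+v\<in>{0<..<1}. (ennreal ((1 + s) / (1 + s * (1 / (?K + v)))\<^sup>2)
       * F (digit (1 / (?K + v))) (gauss_map (1 / (?K + v)))
       * ennreal (1 / (?K + v)\<^sup>2)) \<partial>lborel) =
      (\<integral>\<^sup>+v. ennreal (digit_prob (Suc k) s) *
        (ennreal ((1 + ?s') / (1 + ?s' * v)\<^sup>2) * F (Suc k) v * indicator {0<..<1} v) \<partial>lborel)"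
    proof (intro nn_integral_cong)
      fix v :: real
      show "ennreal ((1 + s) / (1 + s * (1 / (?K + v)))\<^sup>2)
       * F (digit (1 / (?K + v))) (gauss_map (1 / (?K + v)))
       * ennreal (1 / (?K + v)\<^sup>2) * indicator {0<..<1} v = ennreal (digit_prob (Suc k) s) *
        (ennreal ((1 + ?s') / (1 + ?s' * v)\<^sup>2) * F (Suc k) v * indicator {0<..<1} v)"
      proof (cases "v \<in> {0<..<1}")
        case True
        then have v: "0 < v" "v < 1" by auto
        have b: "0 \<le> 1 / (?K + v)\<^sup>2" by simp
        have "ennreal ((1 + s) / (1 + s * (1 / (?K + v)))\<^sup>2) * ennreal (1 / (?K + v)\<^sup>2) =
          ennreal (digit_prob (Suc k) s) * ennreal ((1 + ?s') / (1 + ?s' * v)\<^sup>2)"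
          unfolding ennreal_mult''[OF b, symmetric] ennreal_mult'[OF digit_prob_nonneg[OF s], symmetric] eq[OF v(1)] ..
        then show ?thesis using True v by (simp only: digit_branch mult_ac)
      qed auto
    qed
    also have "\<dots> = ennreal (digit_prob (Suc k) s) * (\<integral>\<^sup>+v. F (Suc k) v \<partial>cf_measure ?s')"
      by (subst nn_integral_cmult) (auto simp: nn_integral_cf_measure)
    finally show "(\<integral>\<^sup>+v\<in>{0<..<1}. (ennreal ((1 + s) / (1 + s * (1 / (?K + v)))\<^sup>2)
       * F (digit (1 / (?K + v))) (gauss_map (1 / (?K + v)))
       * ennreal (1 / (?K + v)\<^sup>2)) \<partial>lborel) = ennreal (digit_prob (Suc k) s) * (\<integral>\<^sup>+v. F (Suc k) v \<partial>cf_measure ?s')" .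
  qed
  finally show ?thesis .
qed

lemma integrable_cf_measure_bounded:
  fixes f :: "real \<Rightarrow> real"
  assumes "0 \<le> s" "f \<in> borel_measurable borel" "\<And>w. \<bar>f w\<bar> \<le> B"
  shows "integrable (cf_measure s) f"
proof -
  interpret prob_space "cf_measure s" by (rule prob_space_cf_measure) fact
  show ?thesis using assms by (intro integrable_const_bound[where B = B]) auto
qed

text \<open>Adding B makes the integrand nonnegative, so the nonnegative version applies; the shift
  can be subtracted again because the weights sum to 1.\<close>

lemma integral_cf_measure_step:
  fixes F :: "nat \<Rightarrow> real \<Rightarrow> real"
  assumes s: "0 \<le> s" and F [measurable]: "\<And>k. F k \<in> borel_measurable borel"
    and bound: "\<And>k v. k \<ge> 1 \<Longrightarrow> \<bar>F k v\<bar> \<le> B"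
  shows "(\<lambda>k. digit_prob (Suc k) s * (\<integral>v. F (Suc k) v \<partial>cf_measure (1 / (real (Suc k) + s))))
    sums (\<integral>w. F (digit w) (gauss_map w) \<partial>cf_measure s)"
proof -
  have [measurable]: "(\<lambda>w. F (digit w) (gauss_map w)) \<in> borel_measurable borel"
    by (rule measurable_compose_countable[of "\<lambda>i w. F i (gauss_map w)"]) measurable
  have int: "integrable (cf_measure s) (\<lambda>w. F (digit w) (gauss_map w))"
    by (rule integrable_cf_measure_bounded[OF s _ bound[OF digit_ge_1]]) measurable
  have int': "integrable (cf_measure s') (F (Suc k))" if "s' \<ge> 0" for s' k
    by (rule integrable_cf_measure_bounded[OF that _ bound]) auto
  have Bint: "(\<integral>w. B + f w \<partial>cf_measure s') = B + (\<integral>w. f w \<partial>cf_measure s')"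
    "integrable (cf_measure s') (\<lambda>w. B + f w)"
    if "s' \<ge> 0" "integrable (cf_measure s') f" for s' and f :: "real \<Rightarrow> real"
  proof -
    interpret prob_space "cf_measure s'" by (rule prob_space_cf_measure) fact
    show "(\<integral>w. B + f w \<partial>cf_measure s') = B + (\<integral>w. f w \<partial>cf_measure s')"
      "integrable (cf_measure s') (\<lambda>w. B + f w)"
      using that(2) prob_space by simp_all
  qed
  have nn: "0 \<le> B + F k v" if "k \<ge> 1" for k v using bound[OF that, of v] by linarith
  have s': "0 \<le> 1 / (real (Suc k) + s)" for k using s by simp
  let ?a = "\<lambda>k. digit_prob (Suc k) s * (\<integral>v. B + F (Suc k) v \<partial>cf_measure (1 / (real (Suc k) + s)))"
  have a_nn: "0 \<le> ?a k" for k
    by (intro mult_nonneg_nonneg digit_prob_nonneg s integral_nonneg_AE AE_I2 nn) simp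
  have "ennreal (\<integral>w. B + F (digit w) (gauss_map w) \<partial>cf_measure s) =
      (\<integral>\<^sup>+w. ennreal (B + F (digit w) (gauss_map w)) \<partial>cf_measure s)"
    by (rule nn_integral_eq_integral[symmetric]) (use Bint(2)[OF s int] nn digit_ge_1 in auto)
  also have "\<dots> = (\<Sum>k. ennreal (digit_prob (Suc k) s) *
      (\<integral>\<^sup>+v. ennreal (B + F (Suc k) v) \<partial>cf_measure (1 / (real (Suc k) + s))))"
    by (rule nn_integral_cf_measure_step[OF s, of "\<lambda>k v. ennreal (B + F k v)"]) measurable
  also have "\<dots> = (\<Sum>k. ennreal (?a k))"
  proof (intro suminf_cong)
    fix k
    have "(\<integral>\<^sup>+v. ennreal (B + F (Suc k) v) \<partial>cf_measure (1 / (real (Suc k) + s))) =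
      ennreal (\<integral>v. B + F (Suc k) v \<partial>cf_measure (1 / (real (Suc k) + s)))"
      by (rule nn_integral_eq_integral) (use Bint(2)[OF s' int'[OF s']] nn in auto)
    then show "ennreal (digit_prob (Suc k) s) *
      (\<integral>\<^sup>+v. ennreal (B + F (Suc k) v) \<partial>cf_measure (1 / (real (Suc k) + s))) = ennreal (?a k)"
      using digit_prob_nonneg[OF s] by (simp add: ennreal_mult')
  qed
  finally have eq: "(\<Sum>k. ennreal (?a k)) = ennreal (\<integral>w. B + F (digit w) (gauss_map w) \<partial>cf_measure s)" ..
  have "(\<lambda>k. ennreal (?a k)) sums ennreal (\<integral>w. B + F (digit w) (gauss_map w) \<partial>cf_measure s)"
    unfolding eq[symmetric] by (rule summable_sums) simp
  then have "?a sums (\<integral>w. B + F (digit w) (gauss_map w) \<partial>cf_measure s)"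
    by (subst (asm) sums_ennreal) (use a_nn nn digit_ge_1 in \<open>auto intro!: integral_nonneg_AE AE_I2\<close>)
  from sums_diff[OF this sums_mult[OF digit_prob_sums[OF s], of B]]
  show ?thesis
    by (simp only: Bint(1)[OF s int] Bint(1)[OF s' int'[OF s']]) (simp add: algebra_simps)
qed

section \<open>The transition operator\<close>

text \<open>\<open>digit_op g s / (1 + s)\<close> is the Gauss transfer operator applied to
  \<open>g w / (1 + w)\<close>. So this is the transfer operator normalised by its invariant
  density, which makes constants fixed points.\<close>

definition digit_op :: "(real \<Rightarrow> real) \<Rightarrow> real \<Rightarrow> real" where
  "digit_op g s = (\<Sum>k. digit_prob (Suc k) s * g (1 / (real (Suc k) + s)))"

lemma branch_unit_interval:
  assumes "0 \<le> s"
  shows "0 \<le> 1 / (real (Suc k) + s)" "1 / (real (Suc k) + s) \<le> 1"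
  using assms by auto

lemma summable_digit_op:
  assumes "0 \<le> s" "\<And>u. 0 \<le> u \<Longrightarrow> u \<le> 1 \<Longrightarrow> \<bar>g u\<bar> \<le> (1::real)"
  shows "summable (\<lambda>k. digit_prob (Suc k) s * g (1 / (real (Suc k) + s)))"
  by (rule summable_comparison_test'[OF sums_summable[OF digit_prob_sums[OF assms(1)]], of 0])
     (use assms digit_prob_nonneg branch_unit_interval in \<open>auto simp: abs_mult intro!: mult_left_le\<close>)

lemma digit_op_range:
  assumes "0 \<le> s" and g: "\<And>u. 0 \<le> u \<Longrightarrow> u \<le> 1 \<Longrightarrow> 0 \<le> g u \<and> g u \<le> 1"
  shows "0 \<le> digit_op g s" "digit_op g s \<le> 1"
proof -
  have g': "0 \<le> g (1 / (real (Suc k) + s)) \<and> g (1 / (real (Suc k) + s)) \<le> 1" for k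
    using branch_unit_interval[OF assms(1)] g by blast
  have sm: "summable (\<lambda>k. digit_prob (Suc k) s * g (1 / (real (Suc k) + s)))"
    by (rule summable_digit_op) (use assms in \<open>auto simp: abs_le_iff intro: order_trans[of _ 0]\<close>)
  show "0 \<le> digit_op g s" unfolding digit_op_def
    by (rule suminf_nonneg[OF sm]) (use g' digit_prob_nonneg assms in auto)
  have "digit_op g s \<le> (\<Sum>k. digit_prob (Suc k) s)" unfolding digit_op_def
    by (rule suminf_le[OF _ sm sums_summable[OF digit_prob_sums[OF assms(1)]]])
       (use g' digit_prob_nonneg[OF assms(1)] in \<open>auto intro: mult_left_le\<close>)
  then show "digit_op g s \<le> 1" using digit_prob_sums[OF assms(1)] by (simp add: sums_iff)
qed

text \<open>The two summands are the costs of moving the argument of g and of moving the weights in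
  the contraction estimate. \<open>23 / 24\<close> is the exact term 5/8 at k = 0 plus the
  telescoping bounds 1/4 and 1/12 for the rest; what matters is that it lies below 1.\<close>

lemma contraction_constant:
  assumes "n \<ge> 1"
  shows "(\<Sum>k<n. 1 / ((real k + 1)\<^sup>2 * (real k + 2)) + 1 / (real k + 2) ^ 3) \<le>
    23 / 24 - 1 / (2 * real n * (real n + 1)) - 1 / (2 * (real n + 1) * (real n + 2))"
  using assms
proof (induction n rule: dec_induct)
  case base
  then show ?case by (simp add: power2_eq_square power3_eq_cube)
next
  case (step n)
  have n: "real n > 0" using step by simp
  have a: "1 / ((real n + 1)\<^sup>2 * (real n + 2)) \<le> 1 / (2 * real n * (real n + 1)) - 1 / (2 * (real n + 1) * (real n + 2))"
    using n by (simp add: divide_simps power2_eq_square) (simp add: algebra_simps)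
  have b: "1 / (real n + 2) ^ 3 \<le> 1 / (2 * (real n + 1) * (real n + 2)) - 1 / (2 * (real n + 2) * (real n + 3))"
    using n by (simp add: divide_simps power3_eq_cube) (simp add: algebra_simps)
  have c: "real (Suc n) = real n + 1" "real n + 1 + 1 = real n + 2" "real n + 1 + 2 = real n + 3" by auto
  show ?case unfolding sum.lessThan_Suc c using step.IH a b by linarith
qed

lemma digit_op_contraction:
  assumes g: "\<And>u. 0 \<le> u \<Longrightarrow> u \<le> 1 \<Longrightarrow> \<bar>g u\<bar> \<le> 1"
    and lip: "\<And>u v. 0 \<le> u \<Longrightarrow> u \<le> 1 \<Longrightarrow> 0 \<le> v \<Longrightarrow> v \<le> 1 \<Longrightarrow> \<bar>g u - g v\<bar> \<le> L * \<bar>u - v\<bar>"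
    and L: "0 \<le> L" and x: "0 \<le> x" "x \<le> 1" and y: "0 \<le> y" "y \<le> 1"
  shows "\<bar>digit_op g x - digit_op g y\<bar> \<le> 23 / 24 * L * \<bar>x - y\<bar>"
proof -
  define G where "G k s = g (1 / (real (Suc k) + s))" for k s
  \<comment> \<open>\<open>k / (k + 1 + s)\<close> is the probability that the digit is at most k,
    so \<open>\<delta>\<close> is the difference of two distribution functions.\<close>
  define \<delta> where "\<delta> k = real k / (real k + 1 + x) - real k / (real k + 1 + y)" for k
  have prob_diff: "digit_prob (Suc k) x - digit_prob (Suc k) y = \<delta> (Suc k) - \<delta> k" for k
    unfolding digit_prob_def \<delta>_def using x y by (simp add: divide_simps) (simp add: algebra_simps)
  \<comment> \<open>\<open>digit_prob (Suc k)\<close> is a difference in \<open>k\<close>, so summation by parts moves the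
    dependence of the weights onto differences of \<open>g\<close>, which the Lipschitz bound controls.\<close>
  have abel: "(\<Sum>k<n. (\<delta> (Suc k) - \<delta> k) * G k y) =
      \<delta> n * G n y + (\<Sum>k<n. \<delta> (Suc k) * (G k y - G (Suc k) y))" for n
    by (induction n) (simp_all add: \<delta>_def[of 0] algebra_simps)
  have partial: "(\<Sum>k<n. digit_prob (Suc k) x * G k x) - (\<Sum>k<n. digit_prob (Suc k) y * G k y) =
      (\<Sum>k<n. digit_prob (Suc k) x * (G k x - G k y) + \<delta> (Suc k) * (G k y - G (Suc k) y)) + \<delta> n * G n y" for n
  proof -
    have "(\<Sum>k<n. digit_prob (Suc k) x * G k x) - (\<Sum>k<n. digit_prob (Suc k) y * G k y) =
      (\<Sum>k<n. digit_prob (Suc k) x * (G k x - G k y)) + (\<Sum>k<n. (\<delta> (Suc k) - \<delta> k) * G k y)"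
      unfolding prob_diff[symmetric] sum_subtractf[symmetric] sum.distrib[symmetric]
      by (intro sum.cong) (auto simp: algebra_simps)
    then show ?thesis by (simp add: abel sum.distrib)
  qed
  have delta_bound: "\<bar>\<delta> k\<bar> \<le> real k / (real k + 1)\<^sup>2 * \<bar>x - y\<bar>" for k
  proof -
    have p: "real k + 1 + x > 0" "real k + 1 + y > 0" using x y by auto
    have "\<delta> k = real k / ((real k + 1 + x) * (real k + 1 + y)) * (y - x)"
      unfolding \<delta>_def using p by (simp add: divide_simps) (simp add: algebra_simps)
    then have "\<bar>\<delta> k\<bar> = real k / ((real k + 1 + x) * (real k + 1 + y)) * \<bar>x - y\<bar>"
      using p by (simp add: abs_mult abs_minus_commute)
    also have "\<dots> \<le> real k / ((real k + 1) * (real k + 1)) * \<bar>x - y\<bar>"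
      using x y by (intro mult_right_mono divide_left_mono mult_mono mult_pos_pos) auto
    finally show ?thesis by (simp add: power2_eq_square)
  qed
  have term1: "\<bar>digit_prob (Suc k) x * (G k x - G k y)\<bar> \<le> 1 / ((real k + 1)\<^sup>2 * (real k + 2)) * (L * \<bar>x - y\<bar>)" for k
  proof -
    let ?K = "real (Suc k)"
    have p: "?K + x > 0" "?K + y > 0" using x y by auto
    have "\<bar>G k x - G k y\<bar> \<le> L * \<bar>1 / (?K + x) - 1 / (?K + y)\<bar>"
      unfolding G_def by (intro lip branch_unit_interval x y)
    also have "1 / (?K + x) - 1 / (?K + y) = (y - x) / ((?K + x) * (?K + y))"
      using p by (simp add: divide_simps)
    also have "L * \<bar>(y - x) / ((?K + x) * (?K + y))\<bar> = 1 / ((?K + x) * (?K + y)) * (L * \<bar>x - y\<bar>)"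
      using p by (simp add: abs_mult abs_minus_commute)
    finally have "\<bar>digit_prob (Suc k) x * (G k x - G k y)\<bar> \<le>
       digit_prob (Suc k) x * (1 / ((?K + x) * (?K + y)) * (L * \<bar>x - y\<bar>))"
      unfolding abs_mult abs_of_nonneg[OF digit_prob_nonneg[OF x(1)]]
      by (rule mult_left_mono) (rule digit_prob_nonneg[OF x(1)])
    also have "\<dots> = (digit_prob (Suc k) x * (1 / ((?K + x) * (?K + y)))) * (L * \<bar>x - y\<bar>)" by simp
    also have "\<dots> \<le> 1 / ((real k + 1)\<^sup>2 * (real k + 2)) * (L * \<bar>x - y\<bar>)"
    proof (intro mult_right_mono)
      have "digit_prob (Suc k) x * (1 / ((?K + x) * (?K + y))) =
        ((1 + x) / (?K + x)) * (1 / ((?K + x) * (?K + 1 + x) * (?K + y)))"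
        unfolding digit_prob_def by simp
      also have "\<dots> \<le> 1 * (1 / (?K * (?K + 1) * ?K))"
        using x y p by (intro mult_mono divide_left_mono mult_pos_pos) auto
      finally show "digit_prob (Suc k) x * (1 / ((?K + x) * (?K + y))) \<le> 1 / ((real k + 1)\<^sup>2 * (real k + 2))"
        by (simp add: power2_eq_square mult_ac add_ac)
    qed (use L in auto)
    finally show ?thesis .
  qed
  have term2: "\<bar>\<delta> (Suc k) * (G k y - G (Suc k) y)\<bar> \<le> 1 / (real k + 2) ^ 3 * (L * \<bar>x - y\<bar>)" for k
  proof -
    let ?K = "real (Suc k)"
    have p: "?K + y > 0" "?K + 1 + y > 0" using y by auto
    have "\<bar>G k y - G (Suc k) y\<bar> \<le> L * \<bar>1 / (?K + y) - 1 / (real (Suc (Suc k)) + y)\<bar>"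
      unfolding G_def by (intro lip branch_unit_interval x y)
    also have "1 / (?K + y) - 1 / (real (Suc (Suc k)) + y) = 1 / ((?K + y) * (?K + 1 + y))"
      using p by (simp add: divide_simps)
    also have "L * \<bar>1 / ((?K + y) * (?K + 1 + y))\<bar> \<le> L * (1 / (?K * (?K + 1)))"
      using p y L by (simp only: abs_of_pos mult_pos_pos zero_less_divide_1_iff)
        (intro mult_left_mono divide_left_mono mult_mono mult_pos_pos, auto)
    finally have "\<bar>\<delta> (Suc k)\<bar> * \<bar>G k y - G (Suc k) y\<bar> \<le>
        (?K / (?K + 1)\<^sup>2 * \<bar>x - y\<bar>) * (L * (1 / (?K * (?K + 1))))"
      using delta_bound[of "Suc k"] L by (intro mult_mono) auto
    also have "\<dots> = 1 / (real k + 2) ^ 3 * (L * \<bar>x - y\<bar>)"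
      by (simp add: power2_eq_square power3_eq_cube add_ac mult_ac)
    finally show ?thesis by (simp add: abs_mult)
  qed
  \<comment> \<open>The remainder \<open>n / (n + 1)^2\<close> is the boundary term of the summation
    by parts. It is controlled by the bound on g instead of L and disappears as n grows.\<close>
  have bound: "\<bar>(\<Sum>k<n. digit_prob (Suc k) x * G k x) - (\<Sum>k<n. digit_prob (Suc k) y * G k y)\<bar> \<le>
      23 / 24 * L * \<bar>x - y\<bar> + real n / (real n + 1)\<^sup>2" if "n \<ge> 1" for n
  proof -
    have "\<bar>\<delta> n * G n y\<bar> \<le> real n / (real n + 1)\<^sup>2 * 1"
    proof -
      have "\<bar>G n y\<bar> \<le> 1" unfolding G_def by (intro g branch_unit_interval y)
      moreover have "real n / (real n + 1)\<^sup>2 * \<bar>x - y\<bar> \<le> real n / (real n + 1)\<^sup>2 * 1"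
        using x y by (intro mult_left_mono) auto
      ultimately have "\<bar>\<delta> n\<bar> * \<bar>G n y\<bar> \<le> (real n / (real n + 1)\<^sup>2 * 1) * 1"
        using order_trans[OF delta_bound] by (intro mult_mono) auto
      then show ?thesis by (simp add: abs_mult)
    qed
    moreover have "\<bar>\<Sum>k<n. digit_prob (Suc k) x * (G k x - G k y) + \<delta> (Suc k) * (G k y - G (Suc k) y)\<bar>
      \<le> 23 / 24 * L * \<bar>x - y\<bar>"
    proof -
      have "\<bar>\<Sum>k<n. digit_prob (Suc k) x * (G k x - G k y) + \<delta> (Suc k) * (G k y - G (Suc k) y)\<bar>
        \<le> (\<Sum>k<n. \<bar>digit_prob (Suc k) x * (G k x - G k y) + \<delta> (Suc k) * (G k y - G (Suc k) y)\<bar>)"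
        by (rule sum_abs)
      also have "\<dots> \<le> (\<Sum>k<n. (1 / ((real k + 1)\<^sup>2 * (real k + 2)) + 1 / (real k + 2) ^ 3) * (L * \<bar>x - y\<bar>))"
      proof (intro sum_mono)
        fix k
        show "\<bar>digit_prob (Suc k) x * (G k x - G k y) + \<delta> (Suc k) * (G k y - G (Suc k) y)\<bar> \<le>
          (1 / ((real k + 1)\<^sup>2 * (real k + 2)) + 1 / (real k + 2) ^ 3) * (L * \<bar>x - y\<bar>)"
          unfolding distrib_right using term1[of k] term2[of k] by linarith
      qed
      also have "\<dots> = (\<Sum>k<n. 1 / ((real k + 1)\<^sup>2 * (real k + 2)) + 1 / (real k + 2) ^ 3) * (L * \<bar>x - y\<bar>)"
        by (rule sum_distrib_right[symmetric])
      also have "\<dots> \<le> 23 / 24 * (L * \<bar>x - y\<bar>)"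
      proof (intro mult_right_mono)
        have "0 \<le> 1 / (2 * real n * (real n + 1))" "0 \<le> 1 / (2 * (real n + 1) * (real n + 2))" by auto
        then show "(\<Sum>k<n. 1 / ((real k + 1)\<^sup>2 * (real k + 2)) + 1 / (real k + 2) ^ 3) \<le> 23 / 24"
          using contraction_constant[OF that] by linarith
      qed (use L in auto)
      finally show ?thesis by simp
    qed
    ultimately show ?thesis unfolding partial by linarith
  qed
  have lim: "(\<lambda>n. \<Sum>k<n. digit_prob (Suc k) s * G k s) \<longlonglongrightarrow> digit_op g s" if "0 \<le> s" for s
    unfolding digit_op_def G_def by (rule summable_LIMSEQ[OF summable_digit_op[OF that g]])
  show ?thesis
  proof (rule LIMSEQ_le)
    show "(\<lambda>n. \<bar>(\<Sum>k<n. digit_prob (Suc k) x * G k x) - (\<Sum>k<n. digit_prob (Suc k) y * G k y)\<bar>)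
      \<longlonglongrightarrow> \<bar>digit_op g x - digit_op g y\<bar>"
      by (intro tendsto_intros lim x y)
    have "(\<lambda>n. real n / (real n + 1)\<^sup>2) \<longlonglongrightarrow> 0" by real_asymp
    from tendsto_add[OF tendsto_const this]
    show "(\<lambda>n. 23 / 24 * L * \<bar>x - y\<bar> + real n / (real n + 1)\<^sup>2) \<longlonglongrightarrow> 23 / 24 * L * \<bar>x - y\<bar>" by simp
  qed (use bound in blast)
qed

definition mean_state :: "nat \<Rightarrow> real \<Rightarrow> real" where
  "mean_state j = (digit_op ^^ j) (\<lambda>s. s)"

lemma mean_state_Suc: "mean_state (Suc j) = digit_op (mean_state j)"
  by (simp add: mean_state_def)

lemma measurable_digit_op [measurable]:
  assumes [measurable]: "g \<in> borel_measurable borel"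
  shows "digit_op g \<in> borel_measurable borel"
  unfolding digit_op_def[abs_def] digit_prob_def by measurable

lemma measurable_mean_state [measurable]: "mean_state j \<in> borel_measurable borel"
  by (induction j) (auto simp: mean_state_Suc mean_state_def[of 0])

lemma mean_state_range:
  assumes "0 \<le> s" "s \<le> 1"
  shows "0 \<le> mean_state j s \<and> mean_state j s \<le> 1"
  using assms
proof (induction j arbitrary: s)
  case 0
  then show ?case by (simp add: mean_state_def)
next
  case (Suc j)
  then show ?case unfolding mean_state_Suc using digit_op_range[of s "mean_state j"] by auto
qed

lemma mean_state_lipschitz:
  assumes "0 \<le> x" "x \<le> 1" "0 \<le> y" "y \<le> 1"
  shows "\<bar>mean_state j x - mean_state j y\<bar> \<le> (23 / 24) ^ j * \<bar>x - y\<bar>"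
  using assms
proof (induction j arbitrary: x y)
  case 0
  then show ?case by (simp add: mean_state_def)
next
  case (Suc j)
  have "\<bar>digit_op (mean_state j) x - digit_op (mean_state j) y\<bar> \<le> 23 / 24 * (23 / 24) ^ j * \<bar>x - y\<bar>"
    by (rule digit_op_contraction) (use Suc mean_state_range in \<open>auto simp: abs_le_iff intro: order_trans[of _ 0]\<close>)
  then show ?case by (simp add: mean_state_Suc)
qed

section \<open>Invariant density and convergence of the mean state\<close>

text \<open>Substituting \<open>w = 1 / (K + v)\<close> turns the density \<open>1 / (1 + w)\<close>
  into \<open>digit_prob K v / (1 + v)\<close>; summing over K reassembles
  \<open>digit_op\<close>.\<close>

lemma gauss_density_invariant:
  assumes [measurable]: "g \<in> borel_measurable borel"
    and g: "\<And>u. 0 \<le> u \<Longrightarrow> u \<le> 1 \<Longrightarrow> 0 \<le> g u \<and> g u \<le> 1"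
  shows "(\<integral>\<^sup>+s\<in>{0<..<1}. ennreal (digit_op g s / (1 + s)) \<partial>lborel) =
    (\<integral>\<^sup>+w\<in>{0<..<1}. ennreal (g w / (1 + w)) \<partial>lborel)"
proof -
  have [measurable]: "digit_prob k \<in> borel_measurable borel" for k
    unfolding digit_prob_def[abs_def] by measurable
  have "(\<integral>\<^sup>+w\<in>{0<..<1}. ennreal (g w / (1 + w)) \<partial>lborel) =
    (\<Sum>k. \<integral>\<^sup>+v\<in>{0<..<1}. (ennreal (g (1 / (real (Suc k) + v)) / (1 + 1 / (real (Suc k) + v)))
       * ennreal (1 / (real (Suc k) + v)\<^sup>2)) \<partial>lborel)"
    by (rule nn_integral_gauss_branches) measurable
  also have "\<dots> = (\<Sum>k. \<integral>\<^sup>+v. ennreal (digit_prob (Suc k) v * g (1 / (real (Suc k) + v)) / (1 + v)) * indicator {0<..<1} v \<partial>lborel)"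
  proof (intro suminf_cong nn_integral_cong)
    fix k and v :: real
    let ?K = "real (Suc k)"
    show "ennreal (g (1 / (?K + v)) / (1 + 1 / (?K + v))) * ennreal (1 / (?K + v)\<^sup>2) * indicator {0<..<1} v =
      ennreal (digit_prob (Suc k) v * g (1 / (?K + v)) / (1 + v)) * indicator {0<..<1} v"
    proof (cases "v \<in> {0<..<1}")
      case True
      then have v: "0 < v" "v < 1" by auto
      have p: "?K + v > 0" "?K + 1 + v > 0" using v by auto
      have b: "0 \<le> 1 / (?K + v)\<^sup>2" by simp
      have "g (1 / (?K + v)) / (1 + 1 / (?K + v)) * (1 / (?K + v)\<^sup>2) = digit_prob (Suc k) v * g (1 / (?K + v)) / (1 + v)"
      proof -
        have "1 + 1 / (?K + v) = (?K + 1 + v) / (?K + v)" using p by (simp add: field_simps)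
        then show ?thesis unfolding digit_prob_def using p v by (simp add: power2_eq_square)
      qed
      then show ?thesis unfolding ennreal_mult''[OF b, symmetric] by simp
    qed auto
  qed
  also have "\<dots> = (\<integral>\<^sup>+v. (\<Sum>k. ennreal (digit_prob (Suc k) v * g (1 / (real (Suc k) + v)) / (1 + v)) * indicator {0<..<1} v) \<partial>lborel)"
    by (rule nn_integral_suminf[symmetric]) measurable
  also have "\<dots> = (\<integral>\<^sup>+s\<in>{0<..<1}. ennreal (digit_op g s / (1 + s)) \<partial>lborel)"
  proof (intro nn_integral_cong)
    fix v :: real
    show "(\<Sum>k. ennreal (digit_prob (Suc k) v * g (1 / (real (Suc k) + v)) / (1 + v)) * indicator {0<..<1} v) =
      ennreal (digit_op g v / (1 + v)) * indicator {0<..<1} v"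
    proof (cases "v \<in> {0<..<1}")
      case True
      then have v: "0 \<le> v" "v < 1" by auto
      have g': "0 \<le> g (1 / (real (Suc k) + v))" for k using branch_unit_interval[OF v(1)] g by blast
      have sm: "summable (\<lambda>k. digit_prob (Suc k) v * g (1 / (real (Suc k) + v)))"
        by (rule summable_digit_op) (use v g in \<open>auto simp: abs_le_iff intro: order_trans[of _ 0]\<close>)
      have "(\<Sum>k. ennreal (digit_prob (Suc k) v * g (1 / (real (Suc k) + v)) / (1 + v))) =
        ennreal (\<Sum>k. digit_prob (Suc k) v * g (1 / (real (Suc k) + v)) / (1 + v))"
        by (rule suminf_ennreal2) (use v g' digit_prob_nonneg[OF v(1)] sm in \<open>auto intro: summable_divide\<close>)
      also have "\<dots> = ennreal (digit_op g v / (1 + v))"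
        unfolding digit_op_def by (subst suminf_divide[OF sm]) simp
      finally show ?thesis using True by simp
    qed auto
  qed
  finally show ?thesis by simp
qed

lemma mean_state_gauss_integral:
  "(\<integral>\<^sup>+w\<in>{0<..<1}. ennreal (mean_state j w / (1 + w)) \<partial>lborel) = ennreal (1 - ln 2)"
proof (induction j)
  case 0
  have "(\<integral>\<^sup>+w\<in>{0<..<1}. ennreal (w / (1 + w)) \<partial>lborel) = ennreal ((1 - ln (1 + 1)) - (0 - ln (1 + 0)))"
    by (rule nn_integral_unit_interval_FTC) (auto intro!: derivative_eq_intros simp: field_simps)
  then show ?case by (simp add: mean_state_def)
next
  case (Suc j)
  then show ?case unfolding mean_state_Suc
    by (subst gauss_density_invariant) (auto simp: mean_state_range)
qed

lemma nn_integral_gauss_const: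
  assumes "0 \<le> a"
  shows "(\<integral>\<^sup>+w\<in>{0<..<1}. ennreal (a / (1 + w)) \<partial>lborel) = ennreal (a * ln 2)"
proof -
  have "(\<integral>\<^sup>+w\<in>{0<..<1}. ennreal (a / (1 + w)) \<partial>lborel) = ennreal (a * ln (1 + 1) - a * ln (1 + 0))"
    by (rule nn_integral_unit_interval_FTC) (use assms in \<open>auto intro!: derivative_eq_intros simp: field_simps\<close>)
  then show ?thesis by simp
qed

text \<open>The mean \<open>(1 - ln 2) / ln 2\<close> of s under the Gauss probability
  density.\<close>

definition state_limit :: real where
  "state_limit = 1 / ln 2 - 1"

lemma state_limit_range: "0 \<le> state_limit" "state_limit \<le> 1"
proof -
  have "ln 2 \<le> (1::real)" using ln_le_minus_one[of "2::real"] by simp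
  then show "0 \<le> state_limit" by (simp add: state_limit_def field_simps)
  have "1 / 2 \<le> ln (2::real)" using ln2_ge_two_thirds by simp
  then show "state_limit \<le> 1" by (simp add: state_limit_def field_simps)
qed

text \<open>The Gauss average of \<open>mean_state j\<close> equals \<open>state_limit\<close> for all \<open>j\<close>, while its
  oscillation decays geometrically.\<close>

lemma mean_state_converges:
  assumes s: "0 \<le> s" "s \<le> 1"
  shows "\<bar>mean_state j s - state_limit\<bar> \<le> (23 / 24) ^ j"
proof -
  define r where "r = (23 / 24 :: real) ^ j"
  have r: "r \<ge> 0" by (simp add: r_def)
  have near: "\<bar>mean_state j s - mean_state j w\<bar> \<le> r" if "0 < w" "w < 1" for w
  proof -
    have "\<bar>mean_state j s - mean_state j w\<bar> \<le> r * \<bar>s - w\<bar>"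
      unfolding r_def by (rule mean_state_lipschitz) (use s that in auto)
    also have "\<dots> \<le> r * 1" using s that r by (intro mult_left_mono) auto
    finally show ?thesis by simp
  qed
  have ln2: "ln (2::real) > 0" by simp
  have lim: "1 - ln 2 = state_limit * ln 2" using ln2 by (simp add: state_limit_def field_simps)
  let ?b = "mean_state j s + r"
  have b: "?b \<ge> 0" using mean_state_range[OF s] r by auto
  have "ennreal (state_limit * ln 2) \<le> ennreal (?b * ln 2)"
    unfolding nn_integral_gauss_const[OF b, symmetric] lim[symmetric] mean_state_gauss_integral[of j, symmetric]
    by (intro nn_integral_mono) (use near in \<open>auto split: split_indicator intro!: ennreal_leI divide_right_mono simp: abs_le_iff algebra_simps\<close>)
  then have 1: "state_limit \<le> ?b" using b ln2 by simp
  \<comment> \<open>The cut at 0 keeps the comparison constant nonnegative, as extended nonnegative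
    integrals require; it stays a lower bound because \<open>mean_state\<close> is
    nonnegative.\<close>
  let ?a = "max 0 (mean_state j s - r)"
  have a: "?a \<ge> 0" by simp
  have "ennreal (?a * ln 2) \<le> ennreal (state_limit * ln 2)"
    unfolding nn_integral_gauss_const[OF a, symmetric] lim[symmetric] mean_state_gauss_integral[of j, symmetric]
  proof (intro nn_integral_mono)
    fix w :: real
    show "ennreal (?a / (1 + w)) * indicator {0<..<1} w \<le> ennreal (mean_state j w / (1 + w)) * indicator {0<..<1} w"
    proof (cases "w \<in> {0<..<1}")
      case True
      then have "?a \<le> mean_state j w" using near[of w] mean_state_range[of w j] by (auto simp: abs_le_iff)
      then show ?thesis using True by (auto intro!: ennreal_leI divide_right_mono)
    qed auto
  qed
  then have 2: "?a \<le> state_limit" using state_limit_range ln2 by simp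
  from 1 2 show ?thesis unfolding r_def[symmetric] by (auto simp: abs_le_iff)
qed

section \<open>Moment bounds\<close>

text \<open>This plays the role of Borel-Cantelli: the whole series has finite expectation, hence
  converges almost surely, and its terms tend to 0.\<close>

lemma AE_tendsto_0_of_summable_integral:
  fixes X :: "nat \<Rightarrow> 'a \<Rightarrow> real"
  assumes int: "\<And>j. integrable M (X j)" and nonneg: "\<And>j w. 0 \<le> X j w"
    and le: "\<And>j. (\<integral>w. X j w \<partial>M) \<le> c j" and c: "summable c"
  shows "AE w in M. (\<lambda>j. X j w) \<longlonglongrightarrow> 0"
proof -
  have [measurable]: "X j \<in> borel_measurable M" for j using int by auto
  have i_nn: "0 \<le> (\<integral>w. X j w \<partial>M)" for j using nonneg by (intro integral_nonneg_AE) auto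
  have c_nn: "0 \<le> c j" for j using i_nn le order_trans by blast
  have "(\<integral>\<^sup>+w. (\<Sum>j. ennreal (X j w)) \<partial>M) = (\<Sum>j. \<integral>\<^sup>+w. ennreal (X j w) \<partial>M)"
    by (rule nn_integral_suminf) measurable
  also have "\<dots> = (\<Sum>j. ennreal (\<integral>w. X j w \<partial>M))"
    by (intro suminf_cong nn_integral_eq_integral int) (use nonneg in auto)
  also have "\<dots> \<le> (\<Sum>j. ennreal (c j))"
    by (intro suminf_le ennreal_leI le) auto
  also have "\<dots> = ennreal (\<Sum>j. c j)" by (rule suminf_ennreal2[OF c_nn c])
  finally have "(\<integral>\<^sup>+w. (\<Sum>j. ennreal (X j w)) \<partial>M) \<noteq> \<infinity>" by (auto simp: top_unique)
  then have "AE w in M. (\<Sum>j. ennreal (X j w)) \<noteq> \<infinity>"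
    by (intro nn_integral_PInf_AE) measurable
  then show ?thesis
  proof eventually_elim
    case (elim w)
    then have "summable (\<lambda>j. X j w)" using nonneg by (intro summable_suminf_not_top) auto
    then show ?case by (rule summable_LIMSEQ_zero)
  qed
qed

text \<open>For \<open>s = 0\<close> the state is \<open>q (n - 1) / q n\<close>.\<close>

primrec cf_state :: "nat \<Rightarrow> real \<Rightarrow> real \<Rightarrow> real" where
  "cf_state 0 s w = s"
| "cf_state (Suc n) s w = cf_state n (1 / (real (digit w) + s)) (gauss_map w)"

text \<open>\<open>cf_mart \<theta> x n s w\<close> is \<open>(1 - \<theta>) ^ N\<close>, where \<open>N\<close> counts the occurrences of \<open>x\<close> among
  the first \<open>n\<close> digits, divided by the product of the one-step conditional expectations
  \<open>1 - \<theta> * digit_prob x (cf_state i s w)\<close>.\<close>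

definition cf_factor :: "real \<Rightarrow> nat \<Rightarrow> real \<Rightarrow> nat \<Rightarrow> real" where
  "cf_factor \<theta> x s k = (1 - \<theta> * of_bool (k = x)) / (1 - \<theta> * digit_prob x s)"

primrec cf_mart :: "real \<Rightarrow> nat \<Rightarrow> nat \<Rightarrow> real \<Rightarrow> real \<Rightarrow> real" where
  "cf_mart \<theta> x 0 s w = 1"
| "cf_mart \<theta> x (Suc n) s w = cf_factor \<theta> x s (digit w) *
     cf_mart \<theta> x n (1 / (real (digit w) + s)) (gauss_map w)"

text \<open>The path enters the logarithm of the compensator of a digit x, to first order, only
  through this sum divided by \<open>x^2\<close>; hence the sum does not involve x.\<close>

definition cf_drift :: "nat \<Rightarrow> real \<Rightarrow> real \<Rightarrow> real" where
  "cf_drift n s w = (\<Sum>j<n. cf_state j s w - state_limit)"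

section \<open>Mean and variance of the drift\<close>

lemma digit_update_range:
  assumes "0 \<le> s" "k \<ge> 1"
  shows "0 \<le> 1 / (real k + s)" "1 / (real k + s) \<le> 1"
  using assms by auto

lemma measurable_cf_state [measurable (raw)]:
  assumes [measurable]: "f \<in> borel_measurable M" "g \<in> borel_measurable M"
  shows "(\<lambda>w. cf_state n (f w) (g w)) \<in> borel_measurable M"
  using assms
proof (induction n arbitrary: f g)
  case (Suc n)
  note [measurable] = Suc.prems
  show ?case unfolding cf_state.simps by (rule Suc.IH) measurable
qed simp

lemma measurable_cf_mart [measurable (raw)]:
  assumes [measurable]: "f \<in> borel_measurable M" "g \<in> borel_measurable M"
  shows "(\<lambda>w. cf_mart \<theta> x n (f w) (g w)) \<in> borel_measurable M"
  using assms
proof (induction n arbitrary: f g)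
  case (Suc n)
  note [measurable] = Suc.prems
  have [measurable]: "(\<lambda>w. cf_mart \<theta> x n (1 / (real (digit (g w)) + f w)) (gauss_map (g w))) \<in> borel_measurable M"
    by (rule Suc.IH) measurable
  show ?case unfolding cf_mart.simps cf_factor_def digit_prob_def by measurable
qed simp

lemma measurable_cf_drift [measurable (raw)]:
  assumes [measurable]: "f \<in> borel_measurable M" "g \<in> borel_measurable M"
  shows "(\<lambda>w. cf_drift n (f w) (g w)) \<in> borel_measurable M"
  unfolding cf_drift_def by measurable

lemma cf_state_range:
  assumes "0 \<le> s" "s \<le> 1"
  shows "0 \<le> cf_state n s w \<and> cf_state n s w \<le> 1"
  using assms
proof (induction n arbitrary: s w)
  case (Suc n)
  show ?case unfolding cf_state.simps
    using Suc.IH digit_update_range[OF Suc.prems(1) digit_ge_1] by blast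
qed simp

lemma cf_drift_Suc:
  "cf_drift (Suc n) s w = (s - state_limit) + cf_drift n (1 / (real (digit w) + s)) (gauss_map w)"
  by (simp add: cf_drift_def sum.lessThan_Suc_shift del: sum.lessThan_Suc)

lemma cf_state_limit_diff:
  assumes "0 \<le> s" "s \<le> 1"
  shows "\<bar>cf_state j s w - state_limit\<bar> \<le> 1"
  using cf_state_range[OF assms, of j w] state_limit_range by (auto simp: abs_le_iff)

lemma cf_drift_bound:
  assumes "0 \<le> s" "s \<le> 1"
  shows "\<bar>cf_drift n s w\<bar> \<le> real n"
proof -
  have "\<bar>cf_drift n s w\<bar> \<le> (\<Sum>j<n. \<bar>cf_state j s w - state_limit\<bar>)"
    unfolding cf_drift_def by (rule sum_abs)
  also have "\<dots> \<le> (\<Sum>j<n. 1)" by (intro sum_mono cf_state_limit_diff assms)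
  finally show ?thesis by simp
qed

lemma integrable_cf_drift:
  assumes "0 \<le> s" "s \<le> 1"
  shows "integrable (cf_measure s) (\<lambda>w. cf_drift n s w)" "integrable (cf_measure s) (\<lambda>w. (cf_drift n s w)\<^sup>2)"
proof -
  show "integrable (cf_measure s) (\<lambda>w. cf_drift n s w)"
    by (rule integrable_cf_measure_bounded[OF assms(1) _ cf_drift_bound[OF assms]]) measurable
  have "\<bar>(cf_drift n s w)\<^sup>2\<bar> \<le> (real n)\<^sup>2" for w
    using power_mono[OF cf_drift_bound[OF assms], of n w 2] by simp
  then show "integrable (cf_measure s) (\<lambda>w. (cf_drift n s w)\<^sup>2)"
    by (rule integrable_cf_measure_bounded[OF assms(1), rotated]) measurable
qed

lemma expectation_cf_state:
  assumes "0 \<le> s" "s \<le> 1"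
  shows "(\<integral>w. cf_state j s w \<partial>cf_measure s) = mean_state j s"
  using assms
proof (induction j arbitrary: s)
  case 0
  then show ?case using prob_space.prob_space[OF prob_space_cf_measure[of s]] by (simp add: mean_state_def)
next
  case (Suc j)
  have "(\<lambda>k. digit_prob (Suc k) s * (\<integral>v. cf_state j (1 / (real (Suc k) + s)) v \<partial>cf_measure (1 / (real (Suc k) + s))))
    sums (\<integral>w. cf_state j (1 / (real (digit w) + s)) (gauss_map w) \<partial>cf_measure s)"
  proof (rule integral_cf_measure_step[OF Suc.prems(1), where B = 1])
    fix k :: nat and v assume "k \<ge> 1"
    then show "\<bar>cf_state j (1 / (real k + s)) v\<bar> \<le> 1"
      using cf_state_range[OF digit_update_range[OF Suc.prems(1)], of k j v] by simp
  qed measurable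
  then show ?case unfolding mean_state_Suc digit_op_def cf_state.simps
    by (simp only: Suc.IH[OF branch_unit_interval[OF Suc.prems(1)]] sums_iff)
qed

text \<open>The mean deviations decay like \<open>(23 / 24) ^ j\<close>, and 24 is the sum of that
  geometric series. The bound is uniform in n and in the starting state, as the variance recursion
  requires.\<close>

lemma expectation_cf_drift:
  assumes s: "0 \<le> s" "s \<le> 1"
  shows "\<bar>\<integral>w. cf_drift n s w \<partial>cf_measure s\<bar> \<le> 24"
proof -
  interpret prob_space "cf_measure s" by (rule prob_space_cf_measure) fact
  have int: "integrable (cf_measure s) (\<lambda>w. cf_state j s w)" for j
    by (rule integrable_cf_measure_bounded[OF s(1), where B = 1]) (use cf_state_range[OF s] in auto)
  have "(\<integral>w. cf_drift n s w \<partial>cf_measure s) = (\<Sum>j<n. mean_state j s - state_limit)"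
    unfolding cf_drift_def using int
    by (subst Bochner_Integration.integral_sum)
       (auto simp: expectation_cf_state[OF s] prob_space[simplified] intro!: sum.cong)
  also have "\<bar>\<dots>\<bar> \<le> (\<Sum>j<n. \<bar>mean_state j s - state_limit\<bar>)" by (rule sum_abs)
  also have "\<dots> \<le> (\<Sum>j<n. (23 / 24) ^ j)" by (intro sum_mono mean_state_converges s)
  also have "\<dots> \<le> (\<Sum>j. (23 / 24 :: real) ^ j)" by (rule sum_le_suminf) auto
  also have "\<dots> = 24" by (subst suminf_geometric) auto
  finally show ?thesis .
qed

text \<open>Splitting off the first step adds at most 1 from its square and 2 * 24 from the cross
  term with the mean of the remaining drift, hence 49 per step.\<close>

lemma cf_drift_second_moment:
  assumes "0 \<le> s" "s \<le> 1"
  shows "(\<integral>w. (cf_drift n s w)\<^sup>2 \<partial>cf_measure s) \<le> 49 * real n"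
  using assms
proof (induction n arbitrary: s)
  case 0
  then show ?case by (simp add: cf_drift_def)
next
  case (Suc n)
  define a where "a = s - state_limit"
  have a: "\<bar>a\<bar> \<le> 1" unfolding a_def using Suc.prems state_limit_range by (auto simp: abs_le_iff)
  have sums: "(\<lambda>k. digit_prob (Suc k) s *
      (\<integral>v. (a + cf_drift n (1 / (real (Suc k) + s)) v)\<^sup>2 \<partial>cf_measure (1 / (real (Suc k) + s))))
    sums (\<integral>w. (a + cf_drift n (1 / (real (digit w) + s)) (gauss_map w))\<^sup>2 \<partial>cf_measure s)"
  proof (rule integral_cf_measure_step[OF Suc.prems(1), where B = "(1 + real n)\<^sup>2"])
    fix k :: nat and v assume k: "k \<ge> 1"
    have "\<bar>a + cf_drift n (1 / (real k + s)) v\<bar> \<le> 1 + real n"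
      using a cf_drift_bound[OF digit_update_range[OF Suc.prems(1) k], of n v] by linarith
    from power_mono[OF this, of 2]
    show "\<bar>(a + cf_drift n (1 / (real k + s)) v)\<^sup>2\<bar> \<le> (1 + real n)\<^sup>2" by simp
  qed measurable
  have le: "(\<integral>v. (a + cf_drift n s' v)\<^sup>2 \<partial>cf_measure s') \<le> 49 + 49 * real n" if s': "0 \<le> s'" "s' \<le> 1" for s'
  proof -
    interpret prob_space "cf_measure s'" by (rule prob_space_cf_measure) fact
    have "(\<integral>v. (a + cf_drift n s' v)\<^sup>2 \<partial>cf_measure s') =
      (\<integral>v. a\<^sup>2 + 2 * a * cf_drift n s' v + (cf_drift n s' v)\<^sup>2 \<partial>cf_measure s')"
      by (intro Bochner_Integration.integral_cong) (auto simp: power2_sum algebra_simps)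
    also have "\<dots> = a\<^sup>2 + 2 * a * (\<integral>v. cf_drift n s' v \<partial>cf_measure s') + (\<integral>v. (cf_drift n s' v)\<^sup>2 \<partial>cf_measure s')"
      using integrable_cf_drift[OF s'] prob_space by simp
    also have "\<dots> \<le> 1 + 48 + 49 * real n"
    proof -
      have "a\<^sup>2 \<le> 1" using a by (simp add: abs_square_le_1)
      moreover have "\<bar>a * (\<integral>v. cf_drift n s' v \<partial>cf_measure s')\<bar> \<le> 1 * 24"
        unfolding abs_mult by (intro mult_mono a expectation_cf_drift s') auto
      ultimately show ?thesis using Suc.IH[OF s'] by (auto simp: abs_le_iff)
    qed
    finally show ?thesis by simp
  qed
  have "(\<integral>w. (a + cf_drift n (1 / (real (digit w) + s)) (gauss_map w))\<^sup>2 \<partial>cf_measure s) \<le> 1 * (49 + 49 * real n)"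
  proof (rule sums_le[OF _ sums sums_mult2[OF digit_prob_sums[OF Suc.prems(1)]]])
    fix k
    show "digit_prob (Suc k) s * (\<integral>v. (a + cf_drift n (1 / (real (Suc k) + s)) v)\<^sup>2 \<partial>cf_measure (1 / (real (Suc k) + s)))
      \<le> digit_prob (Suc k) s * (49 + 49 * real n)"
      by (intro mult_left_mono le branch_unit_interval digit_prob_nonneg Suc.prems)
  qed
  then show ?case unfolding cf_drift_Suc a_def by simp
qed

section \<open>Moments of the martingales\<close>

lemma digit_prob_bounds:
  assumes "0 \<le> s" "s \<le> 1" "x \<ge> 2"
  shows "digit_prob x s \<le> 2 / (real x)\<^sup>2" "digit_prob x s \<le> 1 / 2"
proof -
  have "digit_prob x s \<le> 2 / (real x * real x)"
    unfolding digit_prob_def using assms by (intro frac_le mult_mono mult_pos_pos) auto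
  then show 1: "digit_prob x s \<le> 2 / (real x)\<^sup>2" by (simp add: power2_eq_square)
  have "real x * real x \<ge> 2 * 2" using assms by (intro mult_mono) auto
  then have "2 / (real x)\<^sup>2 \<le> 1 / 2" by (simp add: power2_eq_square divide_simps)
  with 1 show "digit_prob x s \<le> 1 / 2" by linarith
qed

lemma cf_mart_denominator:
  assumes "0 \<le> s" "s \<le> 1" "x \<ge> 2" "0 \<le> \<theta>" "\<theta> \<le> 1"
  shows "1 / 2 \<le> 1 - \<theta> * digit_prob x s"
  using mult_mono[OF assms(5) digit_prob_bounds(2)[OF assms(1-3)]] digit_prob_nonneg[OF assms(1)] by simp

lemma cf_factor_bound:
  assumes "0 \<le> s" "s \<le> 1" "x \<ge> 2" and \<theta>: "0 \<le> \<theta>" "\<theta> \<le> 1"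
  shows "0 \<le> cf_factor \<theta> x s k" "cf_factor \<theta> x s k \<le> 2"
proof -
  note d = cf_mart_denominator[OF assms]
  show "0 \<le> cf_factor \<theta> x s k" unfolding cf_factor_def
    using d \<theta> by (intro divide_nonneg_nonneg) auto
  have "cf_factor \<theta> x s k \<le> 1 / (1 / 2)" unfolding cf_factor_def
    using d \<theta> by (intro frac_le) auto
  then show "cf_factor \<theta> x s k \<le> 2" by simp
qed

lemma mult_bounds:
  fixes a b :: real
  assumes "0 \<le> a \<and> a \<le> A" "0 \<le> b \<and> b \<le> B"
  shows "0 \<le> a * b \<and> a * b \<le> A * B"
  using assms by (auto intro: mult_mono)

text \<open>A crude bound that serves integrability; the quantitative control comes from the second
  moments.\<close>

lemma cf_mart_bound:
  assumes "0 \<le> s" "s \<le> 1" and x: "x \<ge> 2" and \<theta>: "0 \<le> \<theta>" "\<theta> \<le> 1"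
  shows "0 \<le> cf_mart \<theta> x n s w \<and> cf_mart \<theta> x n s w \<le> 2 ^ n"
  using assms(1,2)
proof (induction n arbitrary: s w)
  case (Suc n)
  show ?case unfolding cf_mart.simps power_Suc
    using cf_factor_bound[OF Suc.prems x \<theta>] Suc.IH digit_update_range[OF Suc.prems(1) digit_ge_1]
    by (intro mult_bounds) blast+
qed simp

text \<open>The choices \<open>x = y\<close> and \<open>b = 0\<close> are allowed, so one formula
  gives the mean of a single factor and of a product of two factors.\<close>

lemma digit_prob_sums_two_digits:
  assumes s: "0 \<le> s" and "x \<ge> 1" "y \<ge> 1"
  shows "(\<lambda>k. digit_prob (Suc k) s * (1 - a * of_bool (Suc k = x) - b * of_bool (Suc k = y)))
    sums (1 - a * digit_prob x s - b * digit_prob y s)"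
proof -
  have single: "(\<lambda>k. a * (if k = x - 1 then digit_prob (Suc k) s else 0)) sums (a * digit_prob x s)"
    if "x \<ge> 1" for a x
    using sums_mult[OF sums_single[of "x - 1" "\<lambda>k. digit_prob (Suc k) s"], of a] that by simp
  have "(\<lambda>k. digit_prob (Suc k) s - a * (if k = x - 1 then digit_prob (Suc k) s else 0) -
       b * (if k = y - 1 then digit_prob (Suc k) s else 0)) sums (1 - a * digit_prob x s - b * digit_prob y s)"
    by (intro sums_diff digit_prob_sums s single assms)
  moreover have "(\<lambda>k. digit_prob (Suc k) s - a * (if k = x - 1 then digit_prob (Suc k) s else 0) -
       b * (if k = y - 1 then digit_prob (Suc k) s else 0)) =
    (\<lambda>k. digit_prob (Suc k) s * (1 - a * of_bool (Suc k = x) - b * of_bool (Suc k = y)))"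
    using assms by (auto simp: fun_eq_iff algebra_simps)
  ultimately show ?thesis by simp
qed

lemma expectation_cf_mart:
  assumes "0 \<le> s" "s \<le> 1" and x: "x \<ge> 2" and \<theta>: "0 \<le> \<theta>" "\<theta> \<le> 1"
  shows "(\<integral>w. cf_mart \<theta> x n s w \<partial>cf_measure s) = 1"
  using assms(1,2)
proof (induction n arbitrary: s)
  case 0
  then show ?case using prob_space.prob_space[OF prob_space_cf_measure[of s]] by simp
next
  case (Suc n)
  note s = Suc.prems
  have "(\<lambda>k. digit_prob (Suc k) s * (\<integral>v. cf_factor \<theta> x s (Suc k) *
      cf_mart \<theta> x n (1 / (real (Suc k) + s)) v \<partial>cf_measure (1 / (real (Suc k) + s))))
    sums (\<integral>w. cf_factor \<theta> x s (digit w) *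
      cf_mart \<theta> x n (1 / (real (digit w) + s)) (gauss_map w) \<partial>cf_measure s)"
  proof (rule integral_cf_measure_step[OF s(1), where B = "2 * 2 ^ n"])
    fix k :: nat and v assume k: "k \<ge> 1"
    have "0 \<le> cf_factor \<theta> x s k * cf_mart \<theta> x n (1 / (real k + s)) v \<and>
      cf_factor \<theta> x s k * cf_mart \<theta> x n (1 / (real k + s)) v \<le> 2 * 2 ^ n"
      by (intro mult_bounds cf_mart_bound conjI cf_factor_bound s x \<theta> digit_update_range k)
    then show "\<bar>cf_factor \<theta> x s k * cf_mart \<theta> x n (1 / (real k + s)) v\<bar> \<le> 2 * 2 ^ n" by simp
  qed measurable
  then have "(\<lambda>k. digit_prob (Suc k) s * cf_factor \<theta> x s (Suc k))
    sums (\<integral>w. cf_mart \<theta> x (Suc n) s w \<partial>cf_measure s)"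
    by (simp only: cf_mart.simps integral_mult_right_zero Suc.IH[OF branch_unit_interval[OF s(1)]] mult_1_right)
  moreover have "(\<lambda>k. digit_prob (Suc k) s * cf_factor \<theta> x s (Suc k)) sums 1"
    using sums_divide[OF digit_prob_sums_two_digits[OF s(1), of x x \<theta> 0], of "1 - \<theta> * digit_prob x s"] x
      cf_mart_denominator[OF s x \<theta>] by (simp add: cf_factor_def)
  ultimately show ?case using sums_unique2 by blast
qed

text \<open>For different digits p and q denote the two probabilities: the events exclude each
  other, so the numerator has mean \<open>1 - \<theta> p - \<theta> q\<close>, at most the product
  of the denominators. For equal digits the indicator is idempotent, and the mean exceeds that
  product by at most p \<le> \<open>2 / x^2\<close>; since the product is at least 1/4, this gives
  \<open>8 / x^2\<close>.\<close>

lemma cf_mart_product_factor: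
  assumes s: "0 \<le> s" "s \<le> 1" and x: "x \<ge> 2" and y: "y \<ge> 2" and \<theta>: "0 \<le> \<theta>" "\<theta> \<le> 1"
  shows "\<exists>A. (\<lambda>k. digit_prob (Suc k) s * (cf_factor \<theta> x s (Suc k) * cf_factor \<theta> y s (Suc k))) sums A \<and>
     A \<le> (if x = y then 1 + 8 / (real x)\<^sup>2 else 1)"
proof -
  let ?p = "digit_prob x s" and ?q = "digit_prob y s"
  let ?D = "(1 - \<theta> * ?p) * (1 - \<theta> * ?q)"
  note dx = cf_mart_denominator[OF s x \<theta>] and dy = cf_mart_denominator[OF s y \<theta>]
  have D: "?D > 0" using dx dy by (intro mult_pos_pos) auto
  have pn: "0 \<le> ?p" "0 \<le> ?q" using digit_prob_nonneg s by auto
  show ?thesis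
  proof (cases "x = y")
    case False
    have "(\<lambda>k. digit_prob (Suc k) s * (1 - \<theta> * of_bool (Suc k = x) - \<theta> * of_bool (Suc k = y)) / ?D)
      sums ((1 - \<theta> * ?p - \<theta> * ?q) / ?D)"
      by (intro sums_divide digit_prob_sums_two_digits s) (use x y in auto)
    moreover have "(\<lambda>k. digit_prob (Suc k) s * (1 - \<theta> * of_bool (Suc k = x) - \<theta> * of_bool (Suc k = y)) / ?D) =
      (\<lambda>k. digit_prob (Suc k) s * (cf_factor \<theta> x s (Suc k) * cf_factor \<theta> y s (Suc k)))"
      using False by (auto simp: fun_eq_iff cf_factor_def)
    moreover have "(1 - \<theta> * ?p - \<theta> * ?q) / ?D \<le> 1"
    proof -
      have "0 \<le> (\<theta> * ?p) * (\<theta> * ?q)" using pn \<theta> by simp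
      then show ?thesis using D by (simp add: divide_le_eq algebra_simps)
    qed
    ultimately show ?thesis using False by auto
  next
    case True
    have "(\<lambda>k. digit_prob (Suc k) s * (1 - (2 * \<theta> - \<theta>\<^sup>2) * of_bool (Suc k = x) - 0 * of_bool (Suc k = x)) / ?D)
      sums ((1 - (2 * \<theta> - \<theta>\<^sup>2) * ?p - 0 * ?p) / ?D)"
      by (intro sums_divide digit_prob_sums_two_digits s) (use x y in auto)
    moreover have "(\<lambda>k. digit_prob (Suc k) s * (1 - (2 * \<theta> - \<theta>\<^sup>2) * of_bool (Suc k = x) - 0 * of_bool (Suc k = x)) / ?D) =
      (\<lambda>k. digit_prob (Suc k) s * (cf_factor \<theta> x s (Suc k) * cf_factor \<theta> y s (Suc k)))"
      using True by (auto simp: fun_eq_iff cf_factor_def power2_eq_square algebra_simps)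
    moreover have "(1 - (2 * \<theta> - \<theta>\<^sup>2) * ?p - 0 * ?p) / ?D \<le> 1 + 8 / (real x)\<^sup>2"
    proof -
      have D4: "?D \<ge> 1 / 2 * (1 / 2)" using dx dy by (intro mult_mono) auto
      have "\<theta>\<^sup>2 * ?p \<le> 1 * ?p" using \<theta> pn by (intro mult_right_mono) (auto simp: power_le_one)
      moreover have "0 \<le> (\<theta> * ?p) * (\<theta> * ?p)" by simp
      ultimately have "1 - (2 * \<theta> - \<theta>\<^sup>2) * ?p \<le> ?D + ?p" unfolding True[symmetric]
        by (simp add: algebra_simps power2_eq_square)
      then have "(1 - (2 * \<theta> - \<theta>\<^sup>2) * ?p) / ?D \<le> (?D + ?p) / ?D" using D by (intro divide_right_mono) auto
      also have "\<dots> = 1 + ?p / ?D" using D by (metis add_divide_distrib divide_self less_irrefl)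
      also have "?p / ?D \<le> (2 / (real x)\<^sup>2) / (1 / 2 * (1 / 2))"
        using D4 pn digit_prob_bounds(1)[OF s x] by (intro frac_le) auto
      finally show ?thesis by simp
    qed
    ultimately show ?thesis using True by auto
  qed
qed

lemma cf_mart_product_moment:
  assumes "0 \<le> s" "s \<le> 1" and x: "x \<ge> 2" and y: "y \<ge> 2" and \<theta>: "0 \<le> \<theta>" "\<theta> \<le> 1"
  shows "(\<integral>w. cf_mart \<theta> x n s w * cf_mart \<theta> y n s w \<partial>cf_measure s) \<le>
    (if x = y then 1 + 8 / (real x)\<^sup>2 else 1) ^ n"
  using assms(1,2)
proof (induction n arbitrary: s)
  case 0
  then show ?case using prob_space.prob_space[OF prob_space_cf_measure[of s]] by simp
next
  case (Suc n)
  note s = Suc.prems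
  define K where "K = (if x = y then 1 + 8 / (real x)\<^sup>2 else 1 :: real)"
  have K: "K \<ge> 0" by (simp add: K_def)
  define c where "c k = cf_factor \<theta> x s k * cf_factor \<theta> y s k" for k
  have c: "0 \<le> c k \<and> c k \<le> 2 * 2" for k
    unfolding c_def by (intro mult_bounds conjI cf_factor_bound s x y \<theta>)
  define W where "W s w = cf_mart \<theta> x n s w * cf_mart \<theta> y n s w" for s w
  have W: "0 \<le> W s w \<and> W s w \<le> 2 ^ n * 2 ^ n" if "0 \<le> s" "s \<le> 1" for s w
    unfolding W_def by (intro mult_bounds cf_mart_bound that x y \<theta>)
  have sums: "(\<lambda>k. digit_prob (Suc k) s * (\<integral>v. c (Suc k) * W (1 / (real (Suc k) + s)) v \<partial>cf_measure (1 / (real (Suc k) + s))))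
    sums (\<integral>w. c (digit w) * W (1 / (real (digit w) + s)) (gauss_map w) \<partial>cf_measure s)"
  proof (rule integral_cf_measure_step[OF s(1), where B = "4 * (2 ^ n * 2 ^ n)"])
    fix k :: nat and v assume k: "k \<ge> 1"
    show "\<bar>c k * W (1 / (real k + s)) v\<bar> \<le> 4 * (2 ^ n * 2 ^ n)"
      using mult_bounds[OF c[of k] W[OF digit_update_range[OF s(1) k], of v]] by simp
  qed (unfold W_def, measurable)
  obtain A where A: "(\<lambda>k. digit_prob (Suc k) s * c (Suc k)) sums A" "A \<le> K"
    using cf_mart_product_factor[OF s x y \<theta>] unfolding c_def K_def by blast
  have "(\<integral>w. c (digit w) * W (1 / (real (digit w) + s)) (gauss_map w) \<partial>cf_measure s) \<le> A * K ^ n"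
  proof (rule sums_le[OF _ sums sums_mult2[OF A(1)]])
    fix k
    have "(\<integral>v. W (1 / (real (Suc k) + s)) v \<partial>cf_measure (1 / (real (Suc k) + s))) \<le> K ^ n"
      unfolding W_def K_def by (rule Suc.IH[OF branch_unit_interval[OF s(1)]])
    then show "digit_prob (Suc k) s * (\<integral>v. c (Suc k) * W (1 / (real (Suc k) + s)) v \<partial>cf_measure (1 / (real (Suc k) + s)))
      \<le> digit_prob (Suc k) s * c (Suc k) * K ^ n"
      using c[of "Suc k"] digit_prob_nonneg[OF s(1)]
      by (simp only: integral_mult_right_zero mult.assoc) (intro mult_left_mono, auto)
  qed
  also have "\<dots> \<le> K * K ^ n" using A(2) K by (intro mult_right_mono) auto
  finally show ?case unfolding K_def[symmetric] cf_mart.simps W_def c_def by (simp add: mult_ac)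
qed

text \<open>The tail of the first digit telescopes to \<open>(1 + s) / (L + 1 + s)\<close>. Its
  bound is uniform in s, so the Markov step carries it to every later digit.\<close>

lemma large_digit_probability:
  assumes "0 \<le> s" "s \<le> 1"
  shows "(\<integral>w. of_bool (L < digit ((gauss_map ^^ i) w)) \<partial>cf_measure s) \<le> 2 / (real L + 1)"
  using assms
proof (induction i arbitrary: s)
  case 0
  note s = 0
  \<comment> \<open>The maximum makes the differences vanish for k < L, so telescoping from 0 yields
    exactly the tail beyond L.\<close>
  let ?f = "\<lambda>k. (1 + s) / (real (max k L) + 1 + s)"
  have "(\<lambda>k. digit_prob (Suc k) s * (\<integral>v. of_bool (L < Suc k) \<partial>cf_measure (1 / (real (Suc k) + s))))
    sums (\<integral>w. of_bool (L < digit w) \<partial>cf_measure s)"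
    by (rule integral_cf_measure_step[OF s(1), where B = 1]) auto
  moreover have "(\<integral>v. of_bool P \<partial>cf_measure (1 / (real (Suc k) + s))) = (of_bool P :: real)" for k P
    using prob_space.prob_space[OF prob_space_cf_measure[OF branch_unit_interval(1)[OF s(1)]], of k] by simp
  ultimately have sums: "(\<lambda>k. digit_prob (Suc k) s * of_bool (L < Suc k)) sums (\<integral>w. of_bool (L < digit w) \<partial>cf_measure s)"
    by simp
  have "?f \<longlonglongrightarrow> 0"
  proof (rule tendsto_sandwich[of "\<lambda>_. 0" _ _ "\<lambda>k. (1 + s) / (real k + 1)"])
    show "(\<lambda>k. (1 + s) / (real k + 1)) \<longlonglongrightarrow> 0" by real_asymp
  qed (use s in \<open>auto intro!: always_eventually frac_le\<close>)
  from telescope_sums'[OF this] have "(\<lambda>k. ?f k - ?f (Suc k)) sums ((1 + s) / (real L + 1 + s))" by simp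
  moreover have "(\<lambda>k. ?f k - ?f (Suc k)) = (\<lambda>k. digit_prob (Suc k) s * of_bool (L < Suc k))"
  proof
    fix k
    show "?f k - ?f (Suc k) = digit_prob (Suc k) s * of_bool (L < Suc k)"
    proof (cases "L \<le> k")
      case True
      then show ?thesis using s by (simp add: digit_prob_def max_def divide_simps) (simp add: algebra_simps)
    next
      case False
      then have "max k L = L" "max (Suc k) L = L" by auto
      with False show ?thesis by simp
    qed
  qed
  ultimately have "(\<integral>w. of_bool (L < digit w) \<partial>cf_measure s) = (1 + s) / (real L + 1 + s)"
    using sums sums_unique2 by metis
  also have "\<dots> \<le> 2 / (real L + 1)" using s by (intro frac_le) auto
  finally show ?case by simp
next
  case (Suc i)
  note s = Suc.prems
  have sums: "(\<lambda>k. digit_prob (Suc k) s * (\<integral>v. of_bool (L < digit ((gauss_map ^^ i) v)) \<partial>cf_measure (1 / (real (Suc k) + s))))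
    sums (\<integral>w. of_bool (L < digit ((gauss_map ^^ i) (gauss_map w))) \<partial>cf_measure s)"
    by (rule integral_cf_measure_step[OF s(1), where B = 1]) auto
  have "(\<integral>w. of_bool (L < digit ((gauss_map ^^ i) (gauss_map w))) \<partial>cf_measure s) \<le> 1 * (2 / (real L + 1))"
    by (rule sums_le[OF _ sums sums_mult2[OF digit_prob_sums[OF s(1)]]])
       (intro mult_left_mono Suc.IH branch_unit_interval digit_prob_nonneg s)
  then show ?case by (simp add: funpow_Suc_right del: funpow.simps)
qed

section \<open>Asymptotics of the digit counts\<close>

lemma sum_inverse_squares_tail:
  assumes "m \<ge> 1"
  shows "(\<Sum>x=m..N. 1 / (real x)\<^sup>2) \<le> 2 / real m"
proof (cases "m \<le> N")
  case True
  then have "(\<Sum>x=m..N. 1 / (real x)\<^sup>2) \<le> 2 / real m - 1 / real N"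
  proof (induction N rule: dec_induct)
    case base
    show ?case using assms by (simp add: power2_eq_square divide_simps)
  next
    case (step N)
    have N: "real N > 0" using assms step by simp
    have "1 / (real (Suc N))\<^sup>2 \<le> 1 / real N - 1 / real (Suc N)"
      using N by (simp add: power2_eq_square divide_simps)
    then show ?case using step by simp
  qed
  then show ?thesis using assms by (smt (verit) divide_nonneg_nonneg of_nat_0_le_iff)
qed auto

section \<open>Digit counts and their generating function\<close>

definition digit_count :: "nat \<Rightarrow> nat \<Rightarrow> real \<Rightarrow> nat" where
  "digit_count n x w = (\<Sum>i<n. of_bool (digit ((gauss_map ^^ i) w) = x))"

text \<open>A digit that has not occurred would contribute \<open>1 - z ^ 0 = 0\<close>, so this is
  the sum over all x, kept finite. Unlike the sum of \<open>z ^ N\<close>, it is monotone in n,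
  which is what interpolation between the times \<open>j ^ 4\<close> relies on.\<close>

definition digit_gf :: "real \<Rightarrow> nat \<Rightarrow> real \<Rightarrow> real" where
  "digit_gf z n w = (\<Sum>x | digit_count n x w \<ge> 1. 1 - z ^ digit_count n x w)"

lemma digit_count_Suc: "digit_count (Suc n) x w = of_bool (digit w = x) + digit_count n x (gauss_map w)"
  unfolding digit_count_def sum.lessThan_Suc_shift by (simp add: funpow_swap1)

lemma digit_count_mono: "n \<le> n' \<Longrightarrow> digit_count n x w \<le> digit_count n' x w"
  unfolding digit_count_def by (intro sum_mono2) auto

lemma digit_count_pos_iff: "digit_count n x w \<ge> 1 \<longleftrightarrow> (\<exists>i<n. digit ((gauss_map ^^ i) w) = x)"
proof -
  have "digit_count n x w = 0 \<longleftrightarrow> (\<forall>i<n. digit ((gauss_map ^^ i) w) \<noteq> x)"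
    unfolding digit_count_def by (subst sum_eq_0_iff) auto
  then show ?thesis by (auto simp: Suc_le_eq)
qed

lemma digits_seen_image: "{x. digit_count n x w \<ge> 1} = (\<lambda>i. digit ((gauss_map ^^ i) w)) ` {..<n}"
  unfolding digit_count_pos_iff by auto

lemma finite_digits_seen [simp]: "finite {x. digit_count n x w \<ge> Suc 0}"
  unfolding digits_seen_image[unfolded One_nat_def] by simp

lemma digit_gf_mono:
  assumes "0 \<le> z" "z \<le> 1" "n \<le> n'"
  shows "digit_gf z n w \<le> digit_gf z n' w"
proof -
  have "digit_gf z n w \<le> (\<Sum>x | digit_count n x w \<ge> 1. 1 - z ^ digit_count n' x w)"
    unfolding digit_gf_def
    by (intro sum_mono diff_left_mono power_decreasing digit_count_mono assms)
  also have "\<dots> \<le> digit_gf z n' w" unfolding digit_gf_def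
    using digit_count_mono[OF assms(3)] assms(1,2)
    by (intro sum_mono2) (auto simp: power_le_one intro: order_trans)
  finally show ?thesis .
qed

lemma digit_gf_nonneg: "0 \<le> z \<Longrightarrow> z \<le> 1 \<Longrightarrow> 0 \<le> digit_gf z n w"
  unfolding digit_gf_def by (intro sum_nonneg) (auto simp: power_le_one)

text \<open>A multiplicative Doob decomposition. At \<open>\<theta> = 1\<close> the convention
  \<open>0 ^ 0 = 1\<close> turns the right-hand side into the indicator that x has not
  occurred.\<close>

lemma cf_mart_mult_compensator:
  assumes "0 \<le> s" "s \<le> 1" and x: "x \<ge> 2" and \<theta>: "0 \<le> \<theta>" "\<theta> \<le> 1"
  shows "cf_mart \<theta> x n s w * (\<Prod>i<n. 1 - \<theta> * digit_prob x (cf_state i s w)) = (1 - \<theta>) ^ digit_count n x w"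
  using assms(1,2)
proof (induction n arbitrary: s w)
  case 0
  then show ?case by (simp add: digit_count_def)
next
  case (Suc n)
  have "1 - \<theta> * digit_prob x s \<noteq> 0" using cf_mart_denominator[OF Suc.prems x \<theta>] by simp
  then have "cf_factor \<theta> x s (digit w) * (1 - \<theta> * digit_prob x s) = (1 - \<theta>) ^ of_bool (digit w = x)"
    by (simp add: cf_factor_def)
  moreover have "cf_mart \<theta> x n (1 / (real (digit w) + s)) (gauss_map w) *
      (\<Prod>i<n. 1 - \<theta> * digit_prob x (cf_state i (1 / (real (digit w) + s)) (gauss_map w))) =
      (1 - \<theta>) ^ digit_count n x (gauss_map w)"
    by (intro Suc.IH digit_update_range Suc.prems digit_ge_1)
  ultimately show ?case
    unfolding digit_count_Suc power_add prod.lessThan_Suc_shift by (simp add: mult_ac)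
qed

text \<open>One extra power of \<open>1 / x\<close> is enough: n errors of size
  \<open>1 / x^3\<close>, summed over x \<ge> m, are of order \<open>n / m^2\<close>, which stays
  bounded for m of order \<open>sqrt n\<close>.\<close>

lemma digit_prob_approx:
  assumes s: "0 \<le> s" "s \<le> 1" and x: "x \<ge> 2"
  shows "\<bar>digit_prob x s - (1 + s) / (real x)\<^sup>2\<bar> \<le> 10 / (real x) ^ 3"
proof -
  let ?X = "real x"
  have X: "?X \<ge> 2" using x by simp
  define r where "r = (1 + s) / ?X\<^sup>2 - digit_prob x s"
  have r: "r = (1 + s) * (?X * (1 + 2 * s) + s + s\<^sup>2) / (?X\<^sup>2 * ((?X + s) * (?X + 1 + s)))"
    unfolding r_def digit_prob_def using X s by (simp add: divide_simps) (simp add: algebra_simps power2_eq_square)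
  also have "\<dots> \<le> 2 * (5 * ?X) / (?X\<^sup>2 * (?X * ?X))"
  proof (intro frac_le mult_mono mult_pos_pos)
    have "?X * (1 + 2 * s) \<le> ?X * 3" using X s by (intro mult_left_mono) auto
    moreover have "s\<^sup>2 \<le> 1" using s by (simp add: power_le_one)
    ultimately show "?X * (1 + 2 * s) + s + s\<^sup>2 \<le> 5 * ?X" using X s by linarith
  qed (use X s in auto)
  also have "2 * (5 * ?X) / (?X\<^sup>2 * (?X * ?X)) = 10 / ?X ^ 3"
    using X by (simp add: power2_eq_square power3_eq_cube)
  finally have "r \<le> 10 / ?X ^ 3" .
  moreover have "0 \<le> r"
    unfolding r using X s by (intro divide_nonneg_nonneg mult_nonneg_nonneg add_nonneg_nonneg) auto
  ultimately show ?thesis unfolding r_def by simp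
qed

lemma abs_one_minus_exp_le: "\<bar>1 - exp u\<bar> \<le> \<bar>u\<bar> * exp \<bar>u\<bar>" for u :: real
proof (cases "u \<ge> 0")
  case True
  have "exp u * (1 - u) \<le> exp u * exp (- u)" using exp_ge_add_one_self[of "- u"] by (intro mult_left_mono) auto
  then have "exp u - 1 \<le> u * exp u" by (simp add: exp_minus algebra_simps)
  then show ?thesis using True by simp
next
  case False
  have "1 - exp u \<le> - u" using exp_ge_add_one_self[of u] by linarith
  also have "\<dots> \<le> - u * exp (- u)" using False by (simp add: mult_le_cancel_left)
  finally show ?thesis using False by simp
qed

text \<open>With martingale M, compensator D and \<open>d = D * exp u\<close>, the error equals
  \<open>M * D * (1 - exp u)\<close>. Here \<open>M * D\<close> is a power of
  \<open>1 - \<theta>\<close>, hence at most 1, so the possibly huge M drops out and only u has to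
  be estimated.\<close>

lemma power_digit_count_approx:
  assumes s: "0 \<le> s" "s \<le> 1" and x: "x \<ge> 2" and \<theta>: "0 \<le> \<theta>" "\<theta> \<le> 1"
    and C: "real n \<le> C * (real x)\<^sup>2"
  defines "d \<equiv> exp (- (\<theta> / ln 2) * real n / (real x)\<^sup>2)"
  shows "\<bar>(1 - \<theta>) ^ digit_count n x w - d - d * (cf_mart \<theta> x n s w - 1)\<bar> \<le>
    exp (15 * C) * (\<bar>cf_drift n s w\<bar> / (real x)\<^sup>2 + 14 * real n / (real x) ^ 3)"
proof -
  let ?X = "real x"
  have X: "?X \<ge> 2" using x by simp
  define p where "p i = \<theta> * digit_prob x (cf_state i s w)" for i
  define D where "D = (\<Prod>i<n. 1 - p i)"
  define q where "q = - (\<Sum>i<n. ln (1 - p i))"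
  define u where "u = q - (\<theta> / ln 2) * real n / ?X\<^sup>2"
  define M where "M = cf_mart \<theta> x n s w"
  have st: "0 \<le> cf_state i s w" "cf_state i s w \<le> 1" for i using cf_state_range[OF s] by auto
  have p: "0 \<le> p i" "p i \<le> 1 / 2" "p i \<le> 2 / ?X\<^sup>2" for i
  proof -
    show "0 \<le> p i" unfolding p_def using \<theta> digit_prob_nonneg[OF st(1)] by simp
    show "p i \<le> 1 / 2" unfolding p_def using cf_mart_denominator[OF st x \<theta>] by simp
    have "p i \<le> 1 * digit_prob x (cf_state i s w)" unfolding p_def
      using \<theta> digit_prob_nonneg[OF st(1)] by (intro mult_right_mono) auto
    then show "p i \<le> 2 / ?X\<^sup>2" using digit_prob_bounds(1)[OF st x, of i] by simp
  qed
  have D: "D = exp (- q)"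
  proof -
    have "1 - p i = exp (ln (1 - p i))" for i using p(2)[of i] by simp
    then have "D = (\<Prod>i<n. exp (ln (1 - p i)))" unfolding D_def by (intro prod.cong) auto
    then show ?thesis by (simp add: q_def exp_sum)
  qed
  have MD: "M * D = (1 - \<theta>) ^ digit_count n x w"
    unfolding M_def D_def p_def by (rule cf_mart_mult_compensator[OF s x \<theta>])
  have "(1 - \<theta>) ^ digit_count n x w - d - d * (M - 1) = M * D - d * M"
    unfolding MD by (simp add: algebra_simps)
  also have "\<dots> = M * D * (1 - exp u)"
  proof -
    have "d = D * exp u" unfolding d_def D u_def exp_add[symmetric] by simp
    then show ?thesis by (simp add: algebra_simps)
  qed
  finally have eq: "(1 - \<theta>) ^ digit_count n x w - d - d * (M - 1) = (1 - \<theta>) ^ digit_count n x w * (1 - exp u)"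
    unfolding MD .
  have le: "\<bar>(1 - \<theta>) ^ digit_count n x w - d - d * (M - 1)\<bar> \<le> \<bar>u\<bar> * exp \<bar>u\<bar>"
  proof -
    have "\<bar>(1 - \<theta>) ^ digit_count n x w\<bar> \<le> 1" using \<theta> by (simp add: power_le_one)
    then have "\<bar>(1 - \<theta>) ^ digit_count n x w\<bar> * \<bar>1 - exp u\<bar> \<le> 1 * (\<bar>u\<bar> * exp \<bar>u\<bar>)"
      by (intro mult_mono abs_one_minus_exp_le) auto
    then show ?thesis unfolding eq abs_mult by simp
  qed
  \<comment> \<open>14 = 10 + 4: the error of \<open>digit_prob_approx\<close> plus the quadratic
    term of the logarithm.\<close>
  have ln_approx: "\<bar>- ln (1 - p i) - \<theta> * (1 + cf_state i s w) / ?X\<^sup>2\<bar> \<le> 14 / ?X ^ 3" for i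
  proof -
    have l: "p i \<le> - ln (1 - p i)" "- ln (1 - p i) \<le> p i + 2 * (p i)\<^sup>2"
      using ln_one_minus_pos_lower_bound[OF p(1,2), of i] ln_one_minus_pos_upper_bound[of "p i"] p[of i]
      by auto
    have "2 * (p i)\<^sup>2 \<le> 2 * (2 / ?X\<^sup>2)\<^sup>2" using p[of i] by (intro mult_left_mono power_mono) auto
    also have "\<dots> = 8 / ?X ^ 3 * (1 / ?X)" by (simp add: power2_eq_square power3_eq_cube)
    also have "\<dots> \<le> 8 / ?X ^ 3 * (1 / 2)" using X by (intro mult_left_mono) (auto simp: divide_simps)
    finally have sq: "2 * (p i)\<^sup>2 \<le> 4 / ?X ^ 3" by simp
    have "\<bar>p i - \<theta> * (1 + cf_state i s w) / ?X\<^sup>2\<bar> = \<theta> * \<bar>digit_prob x (cf_state i s w) - (1 + cf_state i s w) / ?X\<^sup>2\<bar>"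
    proof -
      have "p i - \<theta> * (1 + cf_state i s w) / ?X\<^sup>2 = \<theta> * (digit_prob x (cf_state i s w) - (1 + cf_state i s w) / ?X\<^sup>2)"
        by (simp add: p_def algebra_simps)
      then show ?thesis using \<theta> by (simp add: abs_mult)
    qed
    also have "\<dots> \<le> 1 * (10 / ?X ^ 3)" using \<theta> by (intro mult_mono digit_prob_approx st x) auto
    finally show ?thesis using l sq by linarith
  qed
  have u_bound: "\<bar>u\<bar> \<le> \<bar>cf_drift n s w\<bar> / ?X\<^sup>2 + 14 * real n / ?X ^ 3"
  proof -
    have "(\<Sum>i<n. \<theta> * (1 + cf_state i s w) / ?X\<^sup>2) - (\<theta> / ln 2) * real n / ?X\<^sup>2 = \<theta> * cf_drift n s w / ?X\<^sup>2"
    proof -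
      have a: "(\<Sum>i<n. \<theta> * (1 + cf_state i s w) / ?X\<^sup>2) = \<theta> * (\<Sum>i<n. 1 + cf_state i s w) / ?X\<^sup>2"
        by (simp add: sum_distrib_left sum_divide_distrib)
      have b: "(\<Sum>i<n. 1 + cf_state i s w) = cf_drift n s w + real n / ln 2"
        by (simp add: cf_drift_def state_limit_def sum.distrib sum_subtractf algebra_simps)
      show ?thesis unfolding a b by (simp add: distrib_left add_divide_distrib)
    qed
    then have "u = (\<Sum>i<n. - ln (1 - p i) - \<theta> * (1 + cf_state i s w) / ?X\<^sup>2) + \<theta> * cf_drift n s w / ?X\<^sup>2"
      unfolding u_def q_def by (simp add: sum_subtractf sum_negf)
    moreover have "\<bar>\<Sum>i<n. - ln (1 - p i) - \<theta> * (1 + cf_state i s w) / ?X\<^sup>2\<bar> \<le> 14 * real n / ?X ^ 3"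
      using order_trans[OF sum_abs sum_bounded_above[of "{..<n}", OF ln_approx]] by (simp add: mult.commute)
    moreover have "\<bar>\<theta> * cf_drift n s w / ?X\<^sup>2\<bar> \<le> \<bar>cf_drift n s w\<bar> / ?X\<^sup>2"
      unfolding abs_divide abs_mult abs_power2 using \<theta> by (intro divide_right_mono mult_left_le_one_le) auto
    ultimately show ?thesis by linarith
  qed
  \<comment> \<open>15 = 1 + 14: the drift is at most n in absolute value and \<open>n / x^2\<close>
    is at most C.\<close>
  have "\<bar>cf_drift n s w\<bar> / ?X\<^sup>2 + 14 * real n / ?X ^ 3 \<le> 15 * C"
  proof -
    have nC: "real n / ?X\<^sup>2 \<le> C" using C X by (simp add: divide_le_eq)
    have "\<bar>cf_drift n s w\<bar> / ?X\<^sup>2 \<le> real n / ?X\<^sup>2" by (intro divide_right_mono cf_drift_bound s) auto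
    moreover have "14 * real n / ?X ^ 3 \<le> 14 * (real n / ?X\<^sup>2)"
    proof -
      have "real n / ?X ^ 3 \<le> real n / ?X\<^sup>2" using X by (intro divide_left_mono power_increasing) auto
      then show ?thesis by simp
    qed
    ultimately show ?thesis using nC by linarith
  qed
  with u_bound have "\<bar>u\<bar> * exp \<bar>u\<bar> \<le> (\<bar>cf_drift n s w\<bar> / ?X\<^sup>2 + 14 * real n / ?X ^ 3) * exp (15 * C)"
    by (intro mult_mono) auto
  with le show ?thesis unfolding M_def by (simp add: mult.commute)
qed

text \<open>Its variance is small since the martingales of different digits are negatively
  correlated (\<open>cf_mart_product_moment\<close>).\<close>

definition mart_fluctuation :: "real \<Rightarrow> nat \<Rightarrow> nat \<Rightarrow> nat \<Rightarrow> real \<Rightarrow> real" where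
  "mart_fluctuation \<theta> n m N w =
     (\<Sum>x=m..N. exp (- (\<theta> / ln 2) * real n / (real x)\<^sup>2) * (cf_mart \<theta> x n 0 w - 1))"

section \<open>Variance of the martingale sum\<close>

lemma integrable_mart_fluctuation_sq:
  assumes m: "m \<ge> 2" and \<theta>: "0 \<le> \<theta>" "\<theta> \<le> 1"
  shows "integrable (cf_measure 0) (\<lambda>w. (mart_fluctuation \<theta> n m N w)\<^sup>2)"
proof (rule integrable_cf_measure_bounded[where B = "(\<Sum>x=m..N. 1 * (2 ^ n + 1))\<^sup>2"])
  fix w
  have "\<bar>mart_fluctuation \<theta> n m N w\<bar> \<le> (\<Sum>x=m..N. 1 * (2 ^ n + 1))"
    unfolding mart_fluctuation_def
  proof (rule order_trans[OF sum_abs], intro sum_mono)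
    fix x assume "x \<in> {m..N}"
    then have x: "x \<ge> 2" using m by auto
    have "\<bar>cf_mart \<theta> x n 0 w - 1\<bar> \<le> 2 ^ n + 1" using cf_mart_bound[of 0 x \<theta> n w] x \<theta> by auto
    moreover have "exp (- (\<theta> / ln 2) * real n / (real x)\<^sup>2) \<le> 1" using \<theta> by simp
    ultimately show "\<bar>exp (- (\<theta> / ln 2) * real n / (real x)\<^sup>2) * (cf_mart \<theta> x n 0 w - 1)\<bar> \<le> 1 * (2 ^ n + 1)"
      unfolding abs_mult by (intro mult_mono) auto
  qed
  from power_mono[OF this, of 2]
  show "\<bar>(mart_fluctuation \<theta> n m N w)\<^sup>2\<bar> \<le> (\<Sum>x=m..N. 1 * (2 ^ n + 1))\<^sup>2" by simp
qed (unfold mart_fluctuation_def, measurable)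

text \<open>Off-diagonal covariances are at most 0, so only the diagonal counts. There
  \<open>(1 + 8 / x^2) ^ n - 1\<close> is of order \<open>n / x^2\<close>, because this ratio is
  bounded by C; the sum over x \<ge> m costs the factor \<open>2 / m\<close>.\<close>

lemma mart_fluctuation_second_moment:
  assumes m: "m \<ge> 2" and \<theta>: "0 \<le> \<theta>" "\<theta> \<le> 1" and C: "real n \<le> C * (real m)\<^sup>2"
  shows "(\<integral>w. (mart_fluctuation \<theta> n m N w)\<^sup>2 \<partial>cf_measure 0) \<le> 16 * exp (8 * C) * real n / real m"
proof -
  interpret prob_space "cf_measure 0" by (rule prob_space_cf_measure) simp
  define d where "d x = exp (- (\<theta> / ln 2) * real n / (real x)\<^sup>2)" for x :: nat
  define M where "M x w = cf_mart \<theta> x n 0 w" for x w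
  have d: "0 \<le> d x" "d x \<le> 1" for x using \<theta> by (auto simp: d_def)
  have M: "0 \<le> M x w \<and> M x w \<le> 2 ^ n" if "x \<in> {m..N}" for x w
    unfolding M_def by (rule cf_mart_bound) (use that m \<theta> in auto)
  have [measurable]: "M x \<in> borel_measurable borel" for x unfolding M_def by measurable
  have i1: "integrable (cf_measure 0) (M x)" if "x \<in> {m..N}" for x
    by (rule integrable_cf_measure_bounded[where B = "2 ^ n"]) (use M[OF that] in auto)
  have i2: "integrable (cf_measure 0) (\<lambda>w. M x w * M y w)" if "x \<in> {m..N}" "y \<in> {m..N}" for x y
    by (rule integrable_cf_measure_bounded[where B = "2 ^ n * 2 ^ n"])
       (use mult_bounds[OF M[OF that(1)] M[OF that(2)]] in \<open>auto simp: abs_mult[symmetric] simp del: abs_mult\<close>)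
  have prod_eq: "(M x w - 1) * (M y w - 1) = M x w * M y w - M x w - M y w + 1" for x y w
    by (simp add: algebra_simps)
  have i3: "integrable (cf_measure 0) (\<lambda>w. (M x w - 1) * (M y w - 1))" if "x \<in> {m..N}" "y \<in> {m..N}" for x y
    unfolding prod_eq using i1[OF that(1)] i1[OF that(2)] i2[OF that] by auto
  have cov: "(\<integral>w. (M x w - 1) * (M y w - 1) \<partial>cf_measure 0) \<le> of_bool (x = y) * (8 * real n * exp (8 * C)) * (1 / (real x)\<^sup>2)"
    if xy: "x \<in> {m..N}" "y \<in> {m..N}" for x y
  proof -
    have x: "x \<ge> 2" "y \<ge> 2" using xy m by auto
    have e: "(\<integral>w. M x w \<partial>cf_measure 0) = 1" if "x \<ge> 2" for x
      unfolding M_def by (rule expectation_cf_mart) (use that \<theta> in auto)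
    have "(\<integral>w. (M x w - 1) * (M y w - 1) \<partial>cf_measure 0) = (\<integral>w. M x w * M y w \<partial>cf_measure 0) - 1"
      unfolding prod_eq using i1[OF xy(1)] i1[OF xy(2)] i2[OF xy] e[OF x(1)] e[OF x(2)] prob_space by simp
    also have "\<dots> \<le> (if x = y then 1 + 8 / (real x)\<^sup>2 else 1) ^ n - 1"
      unfolding M_def by (intro diff_right_mono cf_mart_product_moment x \<theta>) auto
    also have "\<dots> \<le> of_bool (x = y) * (8 * real n * exp (8 * C)) * (1 / (real x)\<^sup>2)"
    proof (cases "x = y")
      case True
      let ?u = "8 * real n / (real x)\<^sup>2"
      have "(1 + 8 / (real x)\<^sup>2) ^ n \<le> exp (8 / (real x)\<^sup>2) ^ n"
        by (intro power_mono exp_ge_add_one_self) auto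
      also have "\<dots> = exp ?u" by (simp add: exp_of_nat_mult[symmetric] mult.commute)
      finally have "(1 + 8 / (real x)\<^sup>2) ^ n - 1 \<le> ?u * exp ?u"
        using abs_one_minus_exp_le[of ?u] by simp
      also have "?u * exp ?u \<le> ?u * exp (8 * C)"
      proof -
        have "real n \<le> C * (real x)\<^sup>2"
        proof (cases "C \<ge> 0")
          case True
          have "C * (real m)\<^sup>2 \<le> C * (real x)\<^sup>2" using True xy by (intro mult_left_mono power_mono) auto
          then show ?thesis using C by linarith
        next
          case False
          have "C * (real m)\<^sup>2 < 0" using False m by (intro mult_neg_pos) auto
          then show ?thesis using C by simp
        qed
        then have "?u \<le> 8 * C" using x by (simp add: divide_le_eq)
        then show ?thesis by (intro mult_left_mono) auto
      qed
      finally show ?thesis using True by (simp add: mult_ac)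
    qed auto
    finally show ?thesis .
  qed
  have "(\<integral>w. (mart_fluctuation \<theta> n m N w)\<^sup>2 \<partial>cf_measure 0) =
    (\<integral>w. (\<Sum>x=m..N. \<Sum>y=m..N. (d x * d y) * ((M x w - 1) * (M y w - 1))) \<partial>cf_measure 0)"
    unfolding mart_fluctuation_def d_def[symmetric] M_def[symmetric] unfolding power2_eq_square sum_product
    by (intro Bochner_Integration.integral_cong sum.cong) (auto simp: mult_ac)
  also have "\<dots> = (\<Sum>x=m..N. \<Sum>y=m..N. (d x * d y) * (\<integral>w. (M x w - 1) * (M y w - 1) \<partial>cf_measure 0))"
    using i3 by (subst Bochner_Integration.integral_sum, force)+ simp
  also have "\<dots> \<le> (\<Sum>x=m..N. \<Sum>y=m..N. of_bool (x = y) * (8 * real n * exp (8 * C)) * (1 / (real x)\<^sup>2))"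
  proof (intro sum_mono)
    fix x y assume xy: "x \<in> {m..N}" "y \<in> {m..N}"
    let ?b = "of_bool (x = y) * (8 * real n * exp (8 * C)) * (1 / (real x)\<^sup>2)"
    have "(d x * d y) * (\<integral>w. (M x w - 1) * (M y w - 1) \<partial>cf_measure 0) \<le> (d x * d y) * ?b"
      by (intro mult_left_mono cov xy) (use d in auto)
    also have "\<dots> \<le> 1 * ?b"
      using d by (intro mult_right_mono) (auto intro: mult_le_one)
    finally show "(d x * d y) * (\<integral>w. (M x w - 1) * (M y w - 1) \<partial>cf_measure 0) \<le> ?b" by simp
  qed
  also have "\<dots> = (\<Sum>x=m..N. (8 * real n * exp (8 * C)) * (1 / (real x)\<^sup>2))"
    by (intro sum.cong refl) (auto simp: of_bool_def if_distrib if_distribR sum.delta cong: if_cong)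
  also have "\<dots> = (8 * real n * exp (8 * C)) * (\<Sum>x=m..N. 1 / (real x)\<^sup>2)"
    by (rule sum_distrib_left[symmetric])
  also have "\<dots> \<le> (8 * real n * exp (8 * C)) * (2 / real m)"
    by (intro mult_left_mono sum_inverse_squares_tail) (use m in auto)
  finally show ?thesis by (simp add: mult_ac)
qed

section \<open>Truncation and pathwise error bound\<close>

definition large_digit_count :: "nat \<Rightarrow> nat \<Rightarrow> real \<Rightarrow> real" where
  "large_digit_count n L w = (\<Sum>i<n. of_bool (L < digit ((gauss_map ^^ i) w)))"

lemma large_digit_count_expectation:
  "integrable (cf_measure 0) (large_digit_count n L)"
  "(\<integral>w. large_digit_count n L w \<partial>cf_measure 0) \<le> real n * (2 / (real L + 1))"
proof -
  have int: "integrable (cf_measure 0) (\<lambda>w. of_bool (L < digit ((gauss_map ^^ i) w)) :: real)" for i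
    by (rule integrable_cf_measure_bounded[where B = 1]) auto
  then show "integrable (cf_measure 0) (large_digit_count n L)"
    unfolding large_digit_count_def[abs_def] by (intro Bochner_Integration.integrable_sum)
  have "(\<integral>w. large_digit_count n L w \<partial>cf_measure 0) = (\<Sum>i<n. \<integral>w. of_bool (L < digit ((gauss_map ^^ i) w)) \<partial>cf_measure 0)"
    unfolding large_digit_count_def[abs_def] using int by (rule Bochner_Integration.integral_sum)
  also have "\<dots> \<le> (\<Sum>i<n. 2 / (real L + 1))"
    by (intro sum_mono large_digit_probability) auto
  finally show "(\<integral>w. large_digit_count n L w \<partial>cf_measure 0) \<le> real n * (2 / (real L + 1))" by simp
qed

text \<open>Each distinct value above N contributes at most 1 and uses up at least one index with a
  digit above N.\<close>

lemma digit_gf_truncation: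
  assumes z: "0 \<le> z" "z \<le> 1"
  shows "\<bar>digit_gf z n w - (\<Sum>x=1..N. 1 - z ^ digit_count n x w)\<bar> \<le> large_digit_count n N w"
proof -
  let ?S = "{x. digit_count n x w \<ge> 1}" and ?f = "\<lambda>x. 1 - z ^ digit_count n x w"
  have c0: "digit_count n 0 w = 0"
    using digit_count_pos_iff[of n 0 w] digit_ge_1 by (metis less_one not_less not_one_le_zero)
  have "digit_gf z n w = sum ?f (?S \<inter> {..N}) + sum ?f (?S \<inter> {N<..})"
    unfolding digit_gf_def
    by (subst sum.union_disjoint[symmetric]) (auto intro!: sum.cong)
  moreover have "sum ?f (?S \<inter> {..N}) = (\<Sum>x=1..N. ?f x)"
  proof (intro sum.mono_neutral_left)
    have "x \<ge> 1" if "digit_count n x w \<ge> 1" for x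
      using that c0 by (cases x) auto
    then show "?S \<inter> {..N} \<subseteq> {1..N}" by auto
  qed (auto simp: Suc_le_eq intro!: gr0I)
  moreover have "0 \<le> sum ?f (?S \<inter> {N<..})" using z by (intro sum_nonneg) (auto simp: power_le_one)
  moreover have "sum ?f (?S \<inter> {N<..}) \<le> large_digit_count n N w"
  proof -
    have "sum ?f (?S \<inter> {N<..}) \<le> (\<Sum>x\<in>?S \<inter> {N<..}. 1)" using z by (intro sum_mono) auto
    also have "\<dots> = real (card (?S \<inter> {N<..}))" by simp
    also have "card (?S \<inter> {N<..}) \<le> card ((\<lambda>i. digit ((gauss_map ^^ i) w)) ` {i. i < n \<and> N < digit ((gauss_map ^^ i) w)})"
      unfolding digits_seen_image by (intro card_mono) auto
    also have "\<dots> \<le> card {i. i < n \<and> N < digit ((gauss_map ^^ i) w)}" by (rule card_image_le) simp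
    also have "real (card {i. i < n \<and> N < digit ((gauss_map ^^ i) w)}) = large_digit_count n N w"
    proof -
      have "{i. i < n \<and> N < digit ((gauss_map ^^ i) w)} = {..<n} \<inter> {i. N < digit ((gauss_map ^^ i) w)}" by auto
      then show ?thesis unfolding large_digit_count_def by (simp add: of_bool_def sum.If_cases)
    qed
    finally show ?thesis by simp
  qed
  ultimately show ?thesis by (simp add: abs_le_iff)
qed

text \<open>Three ranges of x: below m each term is off by at most 1, from m to N the martingale
  approximation applies with a common C, and above N only the number of large digits enters.\<close>

lemma digit_gf_approx:
  assumes \<theta>: "0 \<le> \<theta>" "\<theta> \<le> 1" and m: "m \<ge> 2" "m \<le> N" and C: "real n \<le> C * (real m)\<^sup>2" "C \<ge> 0"
  shows "\<bar>digit_gf (1 - \<theta>) n w - (\<Sum>x=1..N. 1 - exp (- (\<theta> / ln 2) * real n / (real x)\<^sup>2))\<bar> \<le>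
    real m + \<bar>mart_fluctuation \<theta> n m N w\<bar> +
    exp (15 * C) * (\<bar>cf_drift n 0 w\<bar> + 14 * real n / real m) * (2 / real m) + large_digit_count n N w"
proof -
  define d where "d x = exp (- (\<theta> / ln 2) * real n / (real x)\<^sup>2)" for x :: nat
  define f where "f x = (1 - \<theta>) ^ digit_count n x w" for x
  have d: "0 \<le> d x" "d x \<le> 1" for x using \<theta> by (auto simp: d_def)
  have f: "0 \<le> f x" "f x \<le> 1" for x using \<theta> by (auto simp: f_def power_le_one)
  have "(\<Sum>x=1..N. 1 - f x) - (\<Sum>x=1..N. 1 - d x) = (\<Sum>x=1..N. d x - f x)"
    by (simp add: sum_subtractf)
  also have "\<dots> = (\<Sum>x=1..m-1. d x - f x) + (\<Sum>x=m..N. d x - f x)"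
  proof -
    have "{1..N} = {1..m-1} \<union> {m..N}" using m by auto
    then show ?thesis using m by (simp only:) (rule sum.union_disjoint, auto)
  qed
  also have "(\<Sum>x=m..N. d x - f x) = - mart_fluctuation \<theta> n m N w -
      (\<Sum>x=m..N. f x - d x - d x * (cf_mart \<theta> x n 0 w - 1))"
    unfolding mart_fluctuation_def d_def[symmetric] sum_negf[symmetric] sum_subtractf[symmetric]
    by (intro sum.cong) auto
  finally have eq: "(\<Sum>x=1..N. 1 - f x) - (\<Sum>x=1..N. 1 - d x) = (\<Sum>x=1..m-1. d x - f x) -
     mart_fluctuation \<theta> n m N w - (\<Sum>x=m..N. f x - d x - d x * (cf_mart \<theta> x n 0 w - 1))" by simp
  have "\<bar>\<Sum>x=1..m-1. d x - f x\<bar> \<le> (\<Sum>x=1..m-1. 1)"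
  proof (rule order_trans[OF sum_abs], intro sum_mono)
    show "\<bar>d x - f x\<bar> \<le> 1" for x using d[of x] f[of x] by linarith
  qed
  also have "\<dots> \<le> real m" by simp
  finally have b1: "\<bar>\<Sum>x=1..m-1. d x - f x\<bar> \<le> real m" .
  have "\<bar>\<Sum>x=m..N. f x - d x - d x * (cf_mart \<theta> x n 0 w - 1)\<bar> \<le>
    (\<Sum>x=m..N. exp (15 * C) * (\<bar>cf_drift n 0 w\<bar> + 14 * real n / real m) * (1 / (real x)\<^sup>2))"
  proof (rule order_trans[OF sum_abs], intro sum_mono)
    fix x assume x: "x \<in> {m..N}"
    then have x2: "x \<ge> 2" using m by auto
    have "C * (real m)\<^sup>2 \<le> C * (real x)\<^sup>2" using C x by (intro mult_left_mono power_mono) auto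
    then have Cx: "real n \<le> C * (real x)\<^sup>2" using C by linarith
    have "\<bar>f x - d x - d x * (cf_mart \<theta> x n 0 w - 1)\<bar> \<le>
      exp (15 * C) * (\<bar>cf_drift n 0 w\<bar> / (real x)\<^sup>2 + 14 * real n / (real x) ^ 3)"
      unfolding f_def d_def by (rule power_digit_count_approx[OF _ _ x2 \<theta> Cx]) auto
    also have "14 * real n / (real x) ^ 3 \<le> 14 * real n / real m * (1 / (real x)\<^sup>2)"
    proof -
      have "14 * real n / (real x) ^ 3 = 14 * real n / real x * (1 / (real x)\<^sup>2)"
        by (simp add: power2_eq_square power3_eq_cube)
      also have "\<dots> \<le> 14 * real n / real m * (1 / (real x)\<^sup>2)"
        using x m by (intro mult_right_mono divide_left_mono) auto
      finally show ?thesis .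
    qed
    finally show "\<bar>f x - d x - d x * (cf_mart \<theta> x n 0 w - 1)\<bar> \<le>
       exp (15 * C) * (\<bar>cf_drift n 0 w\<bar> + 14 * real n / real m) * (1 / (real x)\<^sup>2)"
      by (simp add: distrib_left distrib_right add_divide_distrib mult_ac)
  qed
  also have "\<dots> \<le> exp (15 * C) * (\<bar>cf_drift n 0 w\<bar> + 14 * real n / real m) * (2 / real m)"
    unfolding sum_distrib_left[symmetric]
    by (intro mult_left_mono sum_inverse_squares_tail) (use m in auto)
  finally have b2: "\<bar>\<Sum>x=m..N. f x - d x - d x * (cf_mart \<theta> x n 0 w - 1)\<bar> \<le>
    exp (15 * C) * (\<bar>cf_drift n 0 w\<bar> + 14 * real n / real m) * (2 / real m)" .
  have b3: "\<bar>digit_gf (1 - \<theta>) n w - (\<Sum>x=1..N. 1 - f x)\<bar> \<le> large_digit_count n N w"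
    unfolding f_def by (rule digit_gf_truncation) (use \<theta> in auto)
  show ?thesis unfolding d_def[symmetric] using eq b1 b2 b3 by linarith
qed

section \<open>Almost sure convergence of the generating function\<close>

text \<open>Between consecutive fourth powers f is monotone and \<open>sqrt n\<close> changes by the
  factor \<open>(j + 1)^2 / j^2\<close>, which tends to 1.\<close>

lemma monotone_quartic_subsequence_limit:
  fixes f :: "nat \<Rightarrow> real"
  assumes mono: "\<And>m n. m \<le> n \<Longrightarrow> f m \<le> f n" and nonneg: "\<And>n. 0 \<le> f n"
    and lim: "(\<lambda>j. f (Suc j ^ 4) / (real (Suc j))\<^sup>2) \<longlonglongrightarrow> L"
  shows "(\<lambda>n. f n / sqrt (real n)) \<longlonglongrightarrow> L"
proof -
  define r where "r n = nat \<lfloor>root 4 (real n)\<rfloor>" for n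
  have r_le: "r n ^ 4 \<le> n" and r_gt: "n < Suc (r n) ^ 4" for n
  proof -
    have p: "0 \<le> root 4 (real n)" "root 4 (real n) ^ 4 = real n" by auto
    have a: "real (r n) \<le> root 4 (real n)" "root 4 (real n) < real (Suc (r n))"
      using p(1) by (auto simp: r_def) linarith
    have "real (r n) ^ 4 \<le> real n" using power_mono[OF a(1), of 4] p by simp
    then show "r n ^ 4 \<le> n" by (metis of_nat_le_iff of_nat_power)
    have "real n < real (Suc (r n)) ^ 4" using power_strict_mono[OF a(2) p(1), of 4] p by simp
    then show "n < Suc (r n) ^ 4" by (metis of_nat_less_iff of_nat_power)
  qed
  have r_top: "filterlim r at_top sequentially"
    unfolding filterlim_at_top
  proof
    fix K :: nat
    show "\<forall>\<^sub>F n in sequentially. K \<le> r n"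
      using eventually_ge_at_top[of "K ^ 4"]
    proof eventually_elim
      case (elim n)
      then have "K ^ 4 < Suc (r n) ^ 4" using r_gt[of n] by linarith
      then have "K < Suc (r n)" by (rule power_less_imp_less_base) simp
      then show ?case by simp
    qed
  qed
  define A where "A j = f (j ^ 4) / (real j)\<^sup>2" for j
  have A: "A \<longlonglongrightarrow> L"
    using lim unfolding A_def[symmetric] by (rule LIMSEQ_imp_Suc)
  have sq: "(real j)\<^sup>2 \<le> sqrt (real n)" if "j ^ 4 \<le> n" for j n
  proof (rule real_le_rsqrt)
    show "((real j)\<^sup>2)\<^sup>2 \<le> real n" using that by (simp add: power_mult[symmetric] flip: of_nat_power)
  qed
  have sq': "sqrt (real n) \<le> (real j)\<^sup>2" if "n \<le> j ^ 4" for j n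
  proof (rule real_le_lsqrt)
    show "real n \<le> ((real j)\<^sup>2)\<^sup>2" using that by (simp add: power_mult[symmetric] flip: of_nat_power)
  qed auto
  have r_pos: "\<forall>\<^sub>F n in sequentially. r n \<ge> 1" using r_top by (simp add: filterlim_at_top)
  have lo: "(\<lambda>j. A j * ((real j)\<^sup>2 / (real (Suc j))\<^sup>2)) \<longlonglongrightarrow> L * 1"
    by (intro tendsto_mult A) real_asymp
  have hi: "(\<lambda>j. A (Suc j) * ((real (Suc j))\<^sup>2 / (real j)\<^sup>2)) \<longlonglongrightarrow> L * 1"
    by (intro tendsto_mult LIMSEQ_Suc A) real_asymp
  show ?thesis
  proof (rule tendsto_sandwich)
    show "(\<lambda>n. A (r n) * ((real (r n))\<^sup>2 / (real (Suc (r n)))\<^sup>2)) \<longlonglongrightarrow> L"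
      using filterlim_compose[OF lo r_top] by simp
    show "(\<lambda>n. A (Suc (r n)) * ((real (Suc (r n)))\<^sup>2 / (real (r n))\<^sup>2)) \<longlonglongrightarrow> L"
      using filterlim_compose[OF hi r_top] by simp
    show "\<forall>\<^sub>F n in sequentially. A (r n) * ((real (r n))\<^sup>2 / (real (Suc (r n)))\<^sup>2) \<le> f n / sqrt (real n)"
      using r_pos
    proof eventually_elim
      case (elim n)
      have n: "n \<ge> 1" using elim r_le[of n] by (metis One_nat_def Suc_leI le_trans one_le_power)
      have "A (r n) * ((real (r n))\<^sup>2 / (real (Suc (r n)))\<^sup>2) = f (r n ^ 4) / (real (Suc (r n)))\<^sup>2"
        using elim by (simp add: A_def)
      also have "\<dots> \<le> f n / sqrt (real n)"
        by (intro frac_le nonneg mono r_le sq' less_imp_le[OF r_gt]) (use n in auto)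
      finally show ?case .
    qed
    show "\<forall>\<^sub>F n in sequentially. f n / sqrt (real n) \<le> A (Suc (r n)) * ((real (Suc (r n)))\<^sup>2 / (real (r n))\<^sup>2)"
      using r_pos
    proof eventually_elim
      case (elim n)
      have "f n / sqrt (real n) \<le> f (Suc (r n) ^ 4) / (real (r n))\<^sup>2"
        by (intro frac_le nonneg mono sq r_le less_imp_le[OF r_gt]) (use elim in auto)
      also have "\<dots> = A (Suc (r n)) * ((real (Suc (r n)))\<^sup>2 / (real (r n))\<^sup>2)"
        unfolding A_def by (simp del: of_nat_Suc power_Suc)
      finally show ?case .
    qed
  qed
qed

lemma AE_digit_gf_subsequence:
  assumes \<theta>: "0 < \<theta>" "\<theta> \<le> 1"
  shows "AE w in cf_measure 0.
    (\<lambda>j. digit_gf (1 - \<theta>) (Suc j ^ 4) w / (real (Suc j))\<^sup>2) \<longlonglongrightarrow> sqrt (pi * (\<theta> / ln 2))"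
proof -
  \<comment> \<open>With t = \<open>sqrt n\<close> the normalised variances are of order
    \<open>1 / t\<close>, summable along fourth powers. The cutoff N = \<open>n^2\<close> makes the
    expected number of larger digits at most \<open>2 / t^2\<close>.\<close>
  define t where "t j = (real (Suc j))\<^sup>2" for j
  define n where "n j = Suc j ^ 4" for j
  define N where "N j = Suc j ^ 8" for j
  \<comment> \<open>About \<open>t / e\<close>; adding 2 ensures both m \<ge> 2 and
    \<open>t \<le> e * m\<close> in spite of rounding.\<close>
  define m where "m e j = (Suc j)\<^sup>2 div e + 2" for e j
  have t1: "t j \<ge> 1" for j unfolding t_def by simp
  have n_t: "real (n j) = (t j)\<^sup>2" for j unfolding n_def t_def by (simp add: power_mult[symmetric] del: of_nat_Suc)
  have N_t: "real (N j) = (t j) ^ 4" for j unfolding N_def t_def by (simp add: power_mult[symmetric] del: of_nat_Suc)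
  have m2: "m e j \<ge> 2" for e j by (simp add: m_def)
  have m_lo: "t j \<le> real e * real (m e j)" if "e \<ge> 1" for e j
  proof -
    have "(Suc j)\<^sup>2 \<le> e * m e j"
    proof -
      have "(Suc j)\<^sup>2 = e * ((Suc j)\<^sup>2 div e) + (Suc j)\<^sup>2 mod e" by simp
      also have "\<dots> \<le> e * ((Suc j)\<^sup>2 div e) + e * 2" using that mod_less_divisor[of e "(Suc j)\<^sup>2"] by linarith
      finally show ?thesis by (simp add: m_def algebra_simps)
    qed
    then have "real ((Suc j)\<^sup>2) \<le> real (e * m e j)" by (rule of_nat_mono)
    then show ?thesis unfolding t_def by (simp only: of_nat_power of_nat_mult)
  qed
  have m_hi: "real (m e j) \<le> t j / real e + 2" for e j
  proof -
    have "real ((Suc j)\<^sup>2 div e) \<le> real ((Suc j)\<^sup>2) / real e"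
    proof (cases "e = 0")
      case False
      have "real ((Suc j)\<^sup>2 div e * e) \<le> real ((Suc j)\<^sup>2)" by (intro of_nat_mono div_times_less_eq_dividend)
      then show ?thesis using False by (simp only: of_nat_mult) (simp add: le_divide_eq)
    qed simp
    then show ?thesis unfolding m_def t_def by (simp only: of_nat_power of_nat_add of_nat_numeral)
  qed
  have summ: "summable (\<lambda>j. c / t j)" for c
  proof -
    have "summable (\<lambda>j. 1 / (real (Suc j))\<^sup>2)"
      using inverse_power_summable[of 2, where ?'a = real] by (subst summable_Suc_iff) (simp add: inverse_eq_divide)
    from summable_mult[OF this, of c] show ?thesis by (simp add: t_def)
  qed
  \<comment> \<open>The exceptional null set must not depend on the accuracy, so e ranges over
    countably many values inside the almost-everywhere statement.\<close>
  have AE1: "AE w in cf_measure 0. \<forall>e\<in>{1..}. (\<lambda>j. (mart_fluctuation \<theta> (n j) (m e j) (N j) w / t j)\<^sup>2) \<longlonglongrightarrow> 0"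
  proof (subst AE_ball_countable, simp, intro ballI)
    fix e :: nat assume "e \<in> {1..}"
    then have e: "e \<ge> 1" by simp
    define C where "C = (real e)\<^sup>2"
    show "AE w in cf_measure 0. (\<lambda>j. (mart_fluctuation \<theta> (n j) (m e j) (N j) w / t j)\<^sup>2) \<longlonglongrightarrow> 0"
    proof (rule AE_tendsto_0_of_summable_integral)
      fix j
      show "integrable (cf_measure 0) (\<lambda>w. (mart_fluctuation \<theta> (n j) (m e j) (N j) w / t j)\<^sup>2)"
        unfolding power_divide using integrable_mart_fluctuation_sq[OF m2, of \<theta>] \<theta> by auto
      have nC: "real (n j) \<le> C * (real (m e j))\<^sup>2"
        unfolding n_t C_def power_mult_distrib[symmetric] using m_lo[OF e, of j] t1[of j] by (intro power_mono) auto
      have "(\<integral>w. (mart_fluctuation \<theta> (n j) (m e j) (N j) w / t j)\<^sup>2 \<partial>cf_measure 0) =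
        (\<integral>w. (mart_fluctuation \<theta> (n j) (m e j) (N j) w)\<^sup>2 \<partial>cf_measure 0) / (t j)\<^sup>2"
        unfolding power_divide by simp
      also have "\<dots> \<le> (16 * exp (8 * C) * real (n j) / real (m e j)) / (t j)\<^sup>2"
        by (intro divide_right_mono mart_fluctuation_second_moment m2 nC) (use \<theta> in auto)
      also have "\<dots> = 16 * exp (8 * C) * (1 / real (m e j))"
        unfolding n_t using t1[of j] by simp
      also have "\<dots> \<le> 16 * exp (8 * C) * (real e / t j)"
        using m_lo[OF e, of j] t1[of j] m2[of e j] by (intro mult_left_mono) (auto simp: divide_simps mult_ac)
      finally show "(\<integral>w. (mart_fluctuation \<theta> (n j) (m e j) (N j) w / t j)\<^sup>2 \<partial>cf_measure 0) \<le>
        (16 * exp (8 * C) * real e) / t j" by simp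
    qed (auto intro: summ)
  qed
  have AE2: "AE w in cf_measure 0. (\<lambda>j. (cf_drift (n j) 0 w / real (n j))\<^sup>2) \<longlonglongrightarrow> 0"
  proof (rule AE_tendsto_0_of_summable_integral)
    fix j
    show "integrable (cf_measure 0) (\<lambda>w. (cf_drift (n j) 0 w / real (n j))\<^sup>2)"
      unfolding power_divide using integrable_cf_drift(2)[of 0 "n j"] by auto
    have "(\<integral>w. (cf_drift (n j) 0 w / real (n j))\<^sup>2 \<partial>cf_measure 0) =
        (\<integral>w. (cf_drift (n j) 0 w)\<^sup>2 \<partial>cf_measure 0) / (real (n j))\<^sup>2"
      unfolding power_divide by simp
    also have "\<dots> \<le> 49 * real (n j) / (real (n j))\<^sup>2"
      by (intro divide_right_mono cf_drift_second_moment) auto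
    also have "\<dots> = 49 / t j * (1 / t j)" unfolding n_t using t1[of j] by (simp add: power2_eq_square)
    also have "\<dots> \<le> 49 / t j * 1" using t1[of j] by (intro mult_left_mono) auto
    finally show "(\<integral>w. (cf_drift (n j) 0 w / real (n j))\<^sup>2 \<partial>cf_measure 0) \<le> 49 / t j" by simp
  qed (auto intro: summ)
  have AE3: "AE w in cf_measure 0. (\<lambda>j. large_digit_count (n j) (N j) w) \<longlonglongrightarrow> 0"
  proof (rule AE_tendsto_0_of_summable_integral)
    fix j
    have "(\<integral>w. large_digit_count (n j) (N j) w \<partial>cf_measure 0) \<le> real (n j) * (2 / (real (N j) + 1))"
      by (rule large_digit_count_expectation)
    also have "\<dots> \<le> (t j)\<^sup>2 * (2 / (t j) ^ 4)"
      unfolding n_t N_t using t1[of j] by (intro mult_left_mono divide_left_mono) (auto intro!: mult_pos_pos add_pos_pos)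
    also have "\<dots> = 2 / t j * (1 / t j)" using t1[of j] by (simp add: power2_eq_square power4_eq_xxxx)
    also have "\<dots> \<le> 2 / t j * 1" using t1[of j] by (intro mult_left_mono) auto
    finally show "(\<integral>w. large_digit_count (n j) (N j) w \<partial>cf_measure 0) \<le> 2 / t j" by simp
    show "0 \<le> large_digit_count (n j) (N j) w" for w
      unfolding large_digit_count_def by (intro sum_nonneg) auto
  qed (auto intro: summ large_digit_count_expectation)
  have rescale: "K * (a + 14 * t\<^sup>2 / m) * (2 / m) / t = 2 * K * ((t / m) * (a / t\<^sup>2) + 14 * (t / m)\<^sup>2 * (1 / t))"
    if "t > 0" "m > 0" for K a t m :: real
  proof -
    have "K * (a + 14 * t\<^sup>2 / m) * (2 / m) / t = 2 * K * (a / (m * t)) + 2 * K * (14 * t\<^sup>2 / (m * m * t))"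
      by (simp add: algebra_simps add_divide_distrib)
    also have "a / (m * t) = (t / m) * (a / t\<^sup>2)" using that by (simp add: power2_eq_square)
    also have "14 * t\<^sup>2 / (m * m * t) = 14 * (t / m)\<^sup>2 * (1 / t)" by (simp add: power2_eq_square)
    finally show ?thesis by (simp only: distrib_left)
  qed
  have t_top: "filterlim t at_top sequentially" unfolding t_def[abs_def] by real_asymp
  have t_inv: "(\<lambda>j. 1 / t j) \<longlonglongrightarrow> 0" unfolding t_def[abs_def] by real_asymp
  let ?S = "\<lambda>j. \<Sum>x=1..N j. 1 - exp (- (\<theta> / ln 2) * real (n j) / (real x)\<^sup>2)"
  have riemann: "(\<lambda>j. ?S j / t j) \<longlonglongrightarrow> sqrt (pi * (\<theta> / ln 2))"
    unfolding n_t
  proof (rule riemann_sum_exp_inverse_square[OF _ t_top])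
    show "filterlim (\<lambda>j. real (N j) / t j) at_top sequentially"
      unfolding N_t t_def by real_asymp
  qed (use \<theta> in auto)
  show ?thesis
    using AE1 AE2 AE3
  proof eventually_elim
    case (elim w)
    have drift0: "(\<lambda>j. \<bar>cf_drift (n j) 0 w / real (n j)\<bar>) \<longlonglongrightarrow> 0"
      using tendsto_real_sqrt[OF elim(2)] by simp
    let ?G = "\<lambda>j. digit_gf (1 - \<theta>) (n j) w"
    have "(\<lambda>j. (?G j - ?S j) / t j) \<longlonglongrightarrow> 0"
    proof (rule LIMSEQ_I)
      fix \<epsilon> :: real assume "\<epsilon> > 0"
      \<comment> \<open>The trivially counted digits cost \<open>1 / e\<close>, made less than half
        of \<open>\<epsilon>\<close>. All other errors are collected in B and vanish as j grows with
        e fixed.\<close>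
      obtain e0 :: nat where e0: "real e0 > 2 / \<epsilon>" using reals_Archimedean2 by blast
      define e where "e = Suc e0"
      have e: "e \<ge> 1" "1 / real e < \<epsilon> / 2"
        using e0 \<open>\<epsilon> > 0\<close> by (auto simp: e_def field_simps)
      define C where "C = (real e)\<^sup>2"
      define B where "B j = 2 * (1 / t j) + \<bar>mart_fluctuation \<theta> (n j) (m e j) (N j) w / t j\<bar> +
         2 * exp (15 * C) * (real e * \<bar>cf_drift (n j) 0 w / real (n j)\<bar> + 14 * C * (1 / t j)) +
         large_digit_count (n j) (N j) w * (1 / t j)" for j
      have fl: "(\<lambda>j. \<bar>mart_fluctuation \<theta> (n j) (m e j) (N j) w / t j\<bar>) \<longlonglongrightarrow> 0"
        using tendsto_real_sqrt[OF bspec[OF elim(1), of e]] e by simp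
      have "B \<longlonglongrightarrow> 2 * 0 + 0 + 2 * exp (15 * C) * (real e * 0 + 14 * C * 0) + 0 * 0"
        unfolding B_def[abs_def] by (intro tendsto_intros fl drift0 t_inv elim(3))
      then have "B \<longlonglongrightarrow> 0" by simp
      from LIMSEQ_D[OF this, of "\<epsilon> / 2"] \<open>\<epsilon> > 0\<close> obtain J where J: "\<And>j. j \<ge> J \<Longrightarrow> \<bar>B j\<bar> < \<epsilon> / 2" by auto
      have "\<bar>(?G j - ?S j) / t j\<bar> < \<epsilon>" if "j \<ge> max J 1" for j
      proof -
        let ?m = "real (m e j)"
        \<comment> \<open>j \<ge> 1 gives t \<ge> 4, enough for m \<le> N.\<close>
        have tj: "t j \<ge> 4" using that power_mono[of 2 "real (Suc j)" 2] by (simp add: t_def)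
        have mN: "m e j \<le> N j"
        proof -
          have "real (m e j) \<le> t j / real e + 2" by (rule m_hi)
          also have "t j / real e \<le> t j" using e tj by (simp add: divide_le_eq mult_le_cancel_left1)
          also have "t j + 2 \<le> 4 * t j" using tj by simp
          also have "\<dots> \<le> t j ^ 3 * t j" using tj power_mono[of 4 "t j" 3] by (intro mult_right_mono) auto
          also have "\<dots> = real (N j)" unfolding N_t by (simp add: power4_eq_xxxx power3_eq_cube)
          finally show ?thesis by simp
        qed
        have nC: "real (n j) \<le> C * ?m\<^sup>2"
          unfolding n_t C_def power_mult_distrib[symmetric] using m_lo[OF e(1), of j] t1[of j] by (intro power_mono) auto
        have "\<bar>?G j - ?S j\<bar> \<le> ?m + \<bar>mart_fluctuation \<theta> (n j) (m e j) (N j) w\<bar> +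
          exp (15 * C) * (\<bar>cf_drift (n j) 0 w\<bar> + 14 * real (n j) / ?m) * (2 / ?m) + large_digit_count (n j) (N j) w"
          by (rule digit_gf_approx[OF _ \<theta>(2) m2 mN nC]) (use \<theta> in \<open>auto simp: C_def\<close>)
        then have "\<bar>?G j - ?S j\<bar> / t j \<le> (?m + \<bar>mart_fluctuation \<theta> (n j) (m e j) (N j) w\<bar> +
          exp (15 * C) * (\<bar>cf_drift (n j) 0 w\<bar> + 14 * real (n j) / ?m) * (2 / ?m) + large_digit_count (n j) (N j) w) / t j"
          using tj by (intro divide_right_mono) auto
        also have "\<dots> = ?m / t j + \<bar>mart_fluctuation \<theta> (n j) (m e j) (N j) w / t j\<bar> +
          2 * exp (15 * C) * ((t j / ?m) * \<bar>cf_drift (n j) 0 w / real (n j)\<bar> + 14 * (t j / ?m)\<^sup>2 * (1 / t j)) +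
          large_digit_count (n j) (N j) w * (1 / t j)"
        proof -
          have "exp (15 * C) * (\<bar>cf_drift (n j) 0 w\<bar> + 14 * real (n j) / ?m) * (2 / ?m) / t j =
            2 * exp (15 * C) * ((t j / ?m) * \<bar>cf_drift (n j) 0 w / real (n j)\<bar> + 14 * (t j / ?m)\<^sup>2 * (1 / t j))"
            unfolding n_t abs_divide abs_power2 by (rule rescale) (use tj m2[of e j] in auto)
          then show ?thesis using tj by (simp only: add_divide_distrib abs_divide) simp
        qed
        also have "\<dots> \<le> (1 / real e + 2 * (1 / t j)) + \<bar>mart_fluctuation \<theta> (n j) (m e j) (N j) w / t j\<bar> +
          2 * exp (15 * C) * (real e * \<bar>cf_drift (n j) 0 w / real (n j)\<bar> + 14 * C * (1 / t j)) +
          large_digit_count (n j) (N j) w * (1 / t j)"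
        proof -
          have "?m / t j \<le> (t j / real e + 2) / t j" using m_hi tj by (intro divide_right_mono) auto
          also have "\<dots> = 1 / real e + 2 * (1 / t j)" using tj by (simp add: add_divide_distrib)
          finally have 1: "?m / t j \<le> 1 / real e + 2 * (1 / t j)" .
          have 2: "t j / ?m \<le> real e" using m_lo[OF e(1), of j] m2[of e j] by (simp add: divide_le_eq)
          then have 3: "(t j / ?m)\<^sup>2 \<le> C" unfolding C_def using tj by (intro power_mono) auto
          show ?thesis
            using tj by (intro add_mono mult_left_mono mult_right_mono 1 2 3 order_refl) auto
        qed
        also have "\<dots> = 1 / real e + B j" by (simp add: B_def)
        finally have "\<bar>?G j - ?S j\<bar> / t j \<le> 1 / real e + B j" .
        then show ?thesis using J[of j] that e(2) tj by (auto simp: abs_divide)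
      qed
      then show "\<exists>J. \<forall>j\<ge>J. norm ((?G j - ?S j) / t j - 0) < \<epsilon>"
        unfolding real_norm_def diff_zero by blast
    qed
    from tendsto_add[OF this riemann]
    have "(\<lambda>j. ?G j / t j) \<longlonglongrightarrow> sqrt (pi * (\<theta> / ln 2))" by (simp add: diff_divide_distrib)
    then show ?case unfolding n_def t_def .
  qed
qed

lemma AE_digit_gf_limit:
  assumes z: "0 \<le> z" "z < 1"
  shows "AE w in cf_measure 0. (\<lambda>n. digit_gf z n w / sqrt (real n)) \<longlonglongrightarrow> sqrt (pi * ((1 - z) / ln 2))"
  using AE_digit_gf_subsequence[of "1 - z"] z
  by (auto elim!: eventually_mono intro!: monotone_quartic_subsequence_limit digit_gf_mono digit_gf_nonneg
        simp del: of_nat_Suc power_Suc)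

section \<open>Transfer to the partial quotients\<close>

lemma gauss_map_irrational:
  assumes "w \<in> {0<..<1} - \<rat>"
  shows "gauss_map w \<in> {0<..<1} - \<rat>"
proof -
  have "1 / w \<notin> \<rat>"
  proof
    assume "1 / w \<in> \<rat>"
    then have "inverse (1 / w) \<in> \<rat>" by (rule Rats_inverse)
    then show False using assms by simp
  qed
  moreover have "1 / w = of_int \<lfloor>1 / w\<rfloor> + gauss_map w" by (simp add: gauss_map_def frac_def)
  ultimately have irr: "gauss_map w \<notin> \<rat>" by (metis Rats_add Rats_of_int)
  then have "gauss_map w \<noteq> 0" by auto
  then show ?thesis using irr frac_lt_1[of "1 / w"] frac_ge_0[of "1 / w"] by (auto simp: gauss_map_def less_le)
qed

lemma cf_count_eq_digit_count:
  assumes "w \<in> {0<..<1} - \<rat>"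
  shows "cf_count n x w = digit_count n x w"
proof -
  have iter: "(gauss_map ^^ i) w \<in> {0<..<1} - \<rat>" for i
    by (induction i) (use assms gauss_map_irrational in auto)
  have dig: "nat \<lfloor>1 / v\<rfloor> = digit v" if "v \<in> {0<..<1} - \<rat>" for v
  proof -
    have "1 \<le> 1 / v" using that by simp
    then have "1 \<le> nat \<lfloor>1 / v\<rfloor>" by linarith
    then show ?thesis unfolding digit_def by (rule max_absorb2[symmetric])
  qed
  have "cf_count n x w = (\<Sum>i\<in>{1..n}. of_bool (cf_digit i w = x))"
    unfolding cf_count_def by (simp add: of_bool_def sum.If_cases Int_def)
  also have "\<dots> = (\<Sum>i\<in>{1..n}. of_bool (digit ((gauss_map ^^ (i - 1)) w) = x))"
    unfolding cf_digit_def using dig[OF iter] by simp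
  also have "\<dots> = digit_count n x w"
    unfolding digit_count_def
    by (rule sum.reindex_bij_witness[of _ Suc "\<lambda>i. i - 1"]) auto
  finally show ?thesis .
qed

lemma digit_gf_0:
  assumes "w \<in> {0<..<1} - \<rat>"
  shows "digit_gf 0 n w = real (cf_range n w)"
proof -
  have "digit_gf 0 n w = (\<Sum>x | digit_count n x w \<ge> 1. 1)"
    unfolding digit_gf_def by (intro sum.cong) (auto simp: zero_power)
  then show ?thesis by (simp add: cf_range_def cf_count_eq_digit_count[OF assms])
qed

lemma digit_count_le: "digit_count n x w \<le> n"
  unfolding digit_count_def using sum_bounded_above[of "{..<n}" "\<lambda>i. of_bool (digit ((gauss_map ^^ i) w) = x)" "1 :: nat"] by simp

text \<open>Grouping the values that occurred by their multiplicity. The coefficient at k = 0 is set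
  to 0 because it would refer to the infinitely many values that did not occur.\<close>

lemma cf_range_k_pgf:
  assumes w: "w \<in> {0<..<1} - \<rat>"
  shows "(\<lambda>k. if k = 0 then 0 else real (cf_range_k n k w) * z ^ k) sums (real (cf_range n w) - digit_gf z n w)"
proof -
  let ?S = "{x. digit_count n x w \<ge> 1}"
  have fin: "finite ?S" by simp
  have card_eq: "cf_range_k n k w = card {x \<in> ?S. digit_count n x w = k}" if "k \<ge> 1" for k
    unfolding cf_range_k_def cf_count_eq_digit_count[OF w] using that by (intro arg_cong[where f = card]) auto
  have "(\<lambda>k. if k = 0 then 0 else real (cf_range_k n k w) * z ^ k) sums
    (\<Sum>k=1..n. if k = 0 then 0 else real (cf_range_k n k w) * z ^ k)"
  proof (rule sums_finite)
    fix k assume k: "k \<notin> {1..n}"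
    show "(if k = 0 then 0 else real (cf_range_k n k w) * z ^ k) = 0"
    proof (cases "k = 0")
      case False
      then have "k > n" using k by auto
      then have "{x \<in> ?S. digit_count n x w = k} = {}" using digit_count_le[of n _ w] by (auto simp: not_le[symmetric])
      then show ?thesis using False card_eq[of k] by simp
    qed simp
  qed simp
  also have "(\<Sum>k=1..n. if k = 0 then 0 else real (cf_range_k n k w) * z ^ k) =
    (\<Sum>k=1..n. \<Sum>x\<in>{x \<in> ?S. digit_count n x w = k}. z ^ digit_count n x w)"
  proof (intro sum.cong refl)
    fix k assume "k \<in> {1..n}"
    then show "(if k = 0 then 0 else real (cf_range_k n k w) * z ^ k) =
       (\<Sum>x\<in>{x \<in> ?S. digit_count n x w = k}. z ^ digit_count n x w)"
      by (simp add: card_eq)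
  qed
  also have "\<dots> = (\<Sum>x\<in>?S. z ^ digit_count n x w)"
    by (rule sum.group) (use digit_count_le fin in auto)
  also have "\<dots> = real (cf_range n w) - digit_gf z n w"
    unfolding digit_gf_def cf_range_def cf_count_eq_digit_count[OF w] by (simp add: sum_subtractf)
  finally show ?thesis .
qed

lemma cf_range_k_le:
  assumes "w \<in> {0<..<1} - \<rat>" "k \<ge> 1"
  shows "cf_range_k n k w \<le> cf_range n w"
  unfolding cf_range_def cf_range_k_def cf_count_eq_digit_count[OF assms(1)]
  using assms(2) by (intro card_mono) auto

lemma cf_range_ratio_limit:
  assumes w: "w \<in> {0<..<1} - \<rat>"
    and R: "(\<lambda>n. real (cf_range n w) / sqrt (real n)) \<longlonglongrightarrow> sqrt (pi / ln 2)"
    and G: "\<And>m. m \<ge> 2 \<Longrightarrow> (\<lambda>n. digit_gf (1 / real m) n w / sqrt (real n)) \<longlonglongrightarrow> sqrt (pi * ((1 - 1 / real m) / ln 2))"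
    and k: "k \<ge> 1"
  shows "(\<lambda>n. real (cf_range_k n k w) / real (cf_range n w)) \<longlonglongrightarrow> r_const k"
proof -
  \<comment> \<open>For k \<ge> 1 both terms lie in [0, 1], so the coefficients are bounded by
    1.\<close>
  define b where "b n k = (if k = 0 then 0 else real (cf_range_k n k w) / real (cf_range n w) - r_const k)" for n k
  have "(\<lambda>n. b n k) \<longlonglongrightarrow> 0"
  proof (rule power_series_coeffs_tendsto_0)
    fix n k
    show "\<bar>b n k\<bar> \<le> 1"
    proof (cases "k = 0")
      case False
      then have "0 \<le> real (cf_range_k n k w) / real (cf_range n w)" "real (cf_range_k n k w) / real (cf_range n w) \<le> 1"
        using cf_range_k_le[OF w, of k n] by (auto simp: divide_le_eq_1)
      moreover have "0 \<le> r_const k" "r_const k \<le> 1" using False r_const_nonneg r_const_le_1 by auto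
      ultimately have "\<bar>real (cf_range_k n k w) / real (cf_range n w) - r_const k\<bar> \<le> 1" by linarith
      then show ?thesis using False by (simp add: b_def)
    qed (simp add: b_def)
  next
    fix m :: nat assume m: "m \<ge> 2"
    define z where "z = 1 / real m"
    have z: "0 \<le> z" "z < 1" using m by (auto simp: z_def)
    have r_sums: "(\<lambda>k. if k = 0 then 0 else r_const k * z ^ k) sums (1 - sqrt (1 - z))"
    proof -
      have "(\<lambda>k. r_const k * z ^ k + (if k = 0 then 1 else 0)) sums (- sqrt (1 - z) + 1)"
        by (intro sums_add r_const_pgf z sums_single[of 0 "\<lambda>_. 1"])
      moreover have "(\<lambda>k. r_const k * z ^ k + (if k = 0 then 1 else 0)) = (\<lambda>k. if k = 0 then 0 else r_const k * z ^ k)"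
        by (auto simp: r_const_def)
      ultimately show ?thesis by simp
    qed
    have eq: "(\<Sum>k. b n k * z ^ k) = sqrt (1 - z) - digit_gf z n w / real (cf_range n w)" if "cf_range n w > 0" for n
    proof -
      have "(\<lambda>k. (if k = 0 then 0 else real (cf_range_k n k w) * z ^ k) / real (cf_range n w) -
         (if k = 0 then 0 else r_const k * z ^ k)) sums
         ((real (cf_range n w) - digit_gf z n w) / real (cf_range n w) - (1 - sqrt (1 - z)))"
        by (intro sums_diff sums_divide cf_range_k_pgf w r_sums)
      moreover have "(\<lambda>k. (if k = 0 then 0 else real (cf_range_k n k w) * z ^ k) / real (cf_range n w) -
         (if k = 0 then 0 else r_const k * z ^ k)) = (\<lambda>k. b n k * z ^ k)"
        by (auto simp: b_def algebra_simps)
      ultimately show ?thesis using that by (simp add: sums_iff diff_divide_distrib)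
    qed
    have pos: "sqrt (pi / ln 2) > 0" by simp
    have "(\<lambda>n. (digit_gf z n w / sqrt (real n)) / (real (cf_range n w) / sqrt (real n))) \<longlonglongrightarrow>
      sqrt (pi * ((1 - z) / ln 2)) / sqrt (pi / ln 2)"
      using G[OF m] R pos unfolding z_def[symmetric] by (intro tendsto_divide) auto
    moreover have "sqrt (pi * ((1 - z) / ln 2)) / sqrt (pi / ln 2) = sqrt (1 - z)"
      by (simp add: real_sqrt_divide[symmetric])
    ultimately have "(\<lambda>n. sqrt (1 - z) - (digit_gf z n w / sqrt (real n)) / (real (cf_range n w) / sqrt (real n))) \<longlonglongrightarrow>
      sqrt (1 - z) - sqrt (1 - z)" by (intro tendsto_intros) simp
    moreover have "\<forall>\<^sub>F n in sequentially. sqrt (1 - z) - (digit_gf z n w / sqrt (real n)) / (real (cf_range n w) / sqrt (real n)) =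
      (\<Sum>k. b n k * z ^ k)"
      \<comment> \<open>The positive limit of \<open>R_n / sqrt n\<close> forces
        \<open>R_n > 0\<close> eventually, so the quotients are genuine ratios and
        \<open>sqrt n\<close> cancels.\<close>
      using order_tendstoD(1)[OF R pos] eventually_gt_at_top[of 0]
    proof eventually_elim
      case (elim n)
      then have "cf_range n w > 0" by (auto intro: gr0I)
      then show ?case using eq elim(2) by simp
    qed
    ultimately show "(\<lambda>n. \<Sum>k. b n k * (1 / real m) ^ k) \<longlonglongrightarrow> 0"
      unfolding z_def[symmetric] by (simp add: Lim_transform_eventually)
  qed
  then have "(\<lambda>n. b n k + r_const k) \<longlonglongrightarrow> 0 + r_const k" by (intro tendsto_intros)
  then show ?thesis using k by (simp add: b_def)
qed

theorem theorem1:
  shows "(AE w in lborel. w \<in> {0<..<1} \<and> w \<notin> \<rat> \<longrightarrow>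
            ((\<lambda>n. real (cf_range n w) / sqrt (real n)) \<longlonglongrightarrow> sqrt (pi / ln 2)) \<and>
            (\<forall>k\<ge>1. (\<lambda>n. real (cf_range_k n k w) / real (cf_range n w)) \<longlonglongrightarrow> r_const k))
         \<and> (\<lambda>k. r_const (k + 1)) sums 1"
proof
  have "AE w in cf_measure 0. (\<lambda>n. digit_gf 0 n w / sqrt (real n)) \<longlonglongrightarrow> sqrt (pi * ((1 - 0) / ln 2))"
    by (rule AE_digit_gf_limit) auto
  moreover have "AE w in cf_measure 0. \<forall>m\<in>{2::nat..}. (\<lambda>n. digit_gf (1 / real m) n w / sqrt (real n)) \<longlonglongrightarrow>
      sqrt (pi * ((1 - 1 / real m) / ln 2))"
    by (subst AE_ball_countable, simp, intro ballI AE_digit_gf_limit) auto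
  ultimately have "AE w in cf_measure 0. w \<in> {0<..<1} \<and> w \<notin> \<rat> \<longrightarrow>
            ((\<lambda>n. real (cf_range n w) / sqrt (real n)) \<longlonglongrightarrow> sqrt (pi / ln 2)) \<and>
            (\<forall>k\<ge>1. (\<lambda>n. real (cf_range_k n k w) / real (cf_range n w)) \<longlonglongrightarrow> r_const k)"
  proof eventually_elim
    case (elim w)
    show ?case
    proof (rule impI, elim conjE)
      assume "w \<in> {0<..<1}" "w \<notin> \<rat>"
      then have w: "w \<in> {0<..<1} - \<rat>" by simp
      have R: "(\<lambda>n. real (cf_range n w) / sqrt (real n)) \<longlonglongrightarrow> sqrt (pi / ln 2)"
        using elim(1) by (simp add: digit_gf_0[OF w])
      then show "((\<lambda>n. real (cf_range n w) / sqrt (real n)) \<longlonglongrightarrow> sqrt (pi / ln 2)) \<and>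
            (\<forall>k\<ge>1. (\<lambda>n. real (cf_range_k n k w) / real (cf_range n w)) \<longlonglongrightarrow> r_const k)"
        using cf_range_ratio_limit[OF w R] elim(2) by simp
    qed
  qed
  then show "AE w in lborel. w \<in> {0<..<1} \<and> w \<notin> \<rat> \<longrightarrow>
            ((\<lambda>n. real (cf_range n w) / sqrt (real n)) \<longlonglongrightarrow> sqrt (pi / ln 2)) \<and>
            (\<forall>k\<ge>1. (\<lambda>n. real (cf_range_k n k w) / real (cf_range n w)) \<longlonglongrightarrow> r_const k)"
    \<comment> \<open>At s = 0 the density is the indicator of the open unit interval, and outside
      that interval the claim is vacuous.\<close>
    unfolding cf_measure_def
    by (subst (asm) AE_density) (auto elim!: eventually_mono)
qed (rule r_const_sums)

end
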